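(* Let $\alpha,\beta$ satisfy $\alpha+\beta>0$ and $\alpha\ge0$, let $\lambda>0$, and assume that $\mathcal M$ and $L$ satisfy the equilibrium hypothesis, the weighted coercivity hypothesis, the large-velocity hypothesis and the scaling hypothesis on the fluid mode, all described in the context. Let $$\zeta:=\begin{cases}2&\text{when }\alpha\ge2+\beta,\\ \frac{\alpha+\beta}{1+\beta}&\text{when }\alpha<2+\beta,\end{cases}\qquad \theta(\varepsilon):=\begin{cases}\varepsilon^\zeta&\text{when }\alpha\in(0,+\infty]\setminus\{2+\beta\},\\ \varepsilon^2|\ln\varepsilon|&\text{when }\alpha=2+\beta,\\ \dfrac{\varepsilon^{\frac\beta{1+\beta}}}{|\ln\varepsilon|}&\text{when }\alpha=0.\end{cases}$$ Then the following limit holds true, with convergence rate explicit in terms of the constants, error terms and convergence rates in the hypotheses: for any $\xi\in\mathbb R^d\setminus\{0\}$, $$\kappa:=\lim_{\varepsilon\to0}\left(\frac{\mu(\varepsilon|\xi|)\,|\xi|^{-\zeta}}{\theta(\varepsilon)\,\langle1,\phi_{\varepsilon|\xi|}\rangle}\right)=\mu_0\times\begin{cases}\|\mathcal M\|_{L^1(\mathbb R^d)}^{-1}&\text{when }\alpha>0,\\[2mm] \dfrac{1+\beta}{|\mathbb S^{d-1}|}&\text{when }\alpha=0,\end{cases}$$ where $\mu_0>0$ is the constant such that $\mu(\eta)\sim_{\eta\to0}\mu_0\Theta(\eta)$.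
   Context: Notation. $d\ge1$, $\lfloor v\rceil:=\sqrt{1+|v|^2}$, $\sigma\in\mathbb S^{d-1}$ (with $\sigma=\xi/|\xi|$ in the claim). $L^2_v(\mathcal M)=L^2(\mathbb R^d;\mathcal M\,dv)$ is a complex Hilbert space with scalar product $\langle g,h\rangle=\int g\bar h\,\mathcal M\,dv$; $\|h\|_k^2:=\int_{\mathbb R^d}|h|^2\lfloor v\rceil^k\mathcal M\,dv$, $\|\cdot\|=\|\cdot\|_0$. $\mathcal M_\beta:=\lfloor\cdot\rceil^{-\beta}\mathcal M$. $L^*$ is the adjoint of $L$ in $L^2_v(\mathcal M)$. $A\lesssim B$ means $A\le cB$ with a constant $c>0$ uniform in the variables and small/large parameters involved. Equilibrium hypothesis. Either (i) $\mathcal M(v)=c_{\alpha,\beta}\lfloor v\rceil^{-(d+\alpha)}$ with $c_{\alpha,\beta}=\big(\int_{\mathbb R^d}\lfloor v\rceil^{-d-\alpha-\beta}dv\big)^{-1}$; or (ii) $\mathcal M$ is a smooth positive radially symmetric function decaying faster than any polynomial, a case denoted "$\alpha=+\infty$". The normalisation is $\int_{\mathbb R^d}\mathcal M_\beta\,dv=1$. Weighted coercivity hypothesis. $L$ is linear, independent of time $t$ and space $x$, commutes with rotations in $v$, is closed and densely defined on $\mathrm{Dom}(L)\subset L^2_v(\mathcal M)$, and satisfies $L(1)=L^*(1)=0$. The operator $\tilde L:=\lfloor\cdot\rceil^{\beta/2}L(\lfloor\cdot\rceil^{\beta/2}\,\cdot\,)$ is closed and densely defined on $\mathrm{Dom}(\tilde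 L)\subset L^2_v(\mathcal M)$ and $-\mathrm{Re}\langle\tilde Lg,g\rangle\ge\lambda\|g\|^2$ for all $g\in\mathrm{Dom}(\tilde L)$ with $g\perp\lfloor\cdot\rceil^{-\beta/2}$. In terms of $L$: $-\mathrm{Re}\langle Lh,h\rangle\ge\lambda\|h-\mathcal Ph\|_{-\beta}^2$ for all $h\in\mathrm{Dom}(L)$, with $\mathcal Ph:=\int_{\mathbb R^d} h\,\mathcal M_\beta\,dv$. Large-velocity hypothesis. Given a smooth $0\le\chi\le1$ equal to $1$ on $B(0,1)$ and $0$ outside $B(0,2)$, with $\chi_R:=\chi(\cdot/R)$ and $\tilde\chi_R:=(v\cdot\sigma)\lfloor v\rceil^\beta\chi_R$ for $R\ge1$: $\|L(\chi_R)\|_\beta\lesssim R^{-\frac{\alpha+\beta}2}$, and $\|L(\tilde\chi_R)\|_\beta\lesssim R^{1+\beta-\frac{\alpha+\beta}2}$ when $\alpha\in(-\beta,2+\beta)$, $\|L(\tilde\chi_R)\|_\beta\lesssim(\ln R)^{1/2}$ when $\alpha=2+\beta$. Fluid mode. Under these three hypotheses there are $\eta_0>0$, $r_0\in(0,\lambda)$ and $0<\mathsf r_0<\mathsf r_1$ such that for all $\eta\in(0,\eta_0)$, $\sigma\in\mathbb S^{d-1}$ there is a unique pair $\phi_\eta\in L^2_v(\lfloor\cdot\rceil^{-\beta}\mathcal M)$, $\mu(\eta)\in B(0,r_0)$ with $-L^*\phi_\eta-i\eta(v\cdot\sigma)\phi_\eta=\mu(\eta)\lfloor v\rceil^{-\beta}\phi_\eta$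 and $\int\phi_\eta\mathcal M_\beta\,dv=1$ (the dependence of $\phi_\eta$ on $\sigma$ is kept implicit); moreover $\mu(\eta)>0$, $\|\phi_\eta-1\|_{-\beta}\lesssim\mu(\eta)^{1/2}$ and $\mu(\eta)\in(\mathsf r_0\Theta(\eta),\mathsf r_1\Theta(\eta))$, where $\Theta(\eta)=\eta^2$ if $\alpha>2+\beta$, $\Theta(\eta)=\eta^2|\ln\eta|$ if $\alpha=2+\beta$, $\Theta(\eta)=\eta^{\frac{\alpha+\beta}{1+\beta}}$ if $-\beta<\alpha<2+\beta$. Under all four hypotheses, $\mu(\eta)\sim_{\eta\to0}\mu_0\Theta(\eta)$ for some constant $\mu_0\in(\mathsf r_0,\mathsf r_1)$. Scaling hypothesis on the fluid mode. Let $|u|_\eta:=(\eta^{\frac2{1+\beta}}+|u|^2)^{1/2}$ and $\Phi_\eta:=\phi_\eta(\eta^{-\frac1{1+\beta}}\,\cdot\,)$. (i) If $\alpha>2+\beta$: for all $\ell<\alpha$, $\|\phi_\eta\|_\ell\lesssim_\ell1$. (ii) If $\alpha\in(-\beta,2+\beta]$: $\Phi_\eta$ converges in $L^2_{\rm loc}(\mathbb R^d\setminus\{0\})$ as $\eta\to0$ to a limit $\Phi$, and for some $\eta_1\in(0,\eta_0)$, $C>0$ and $\delta<\beta+\min(2-\alpha,1)$, for all $\eta\in(0,\eta_1)$ and $u\in\mathbb R^d$: $|\Phi_\eta(u)|\lesssim|u|_\eta^{C\mu(\eta)}$ and $|\mathrm{Im}\,\Phi_\eta(u)|\lesssim|u|_\eta^{\beta+\min(\alpha,1)-\delta}$.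 In addition: (ii-a) if $\alpha=2+\beta$, there are $\mathfrak a:\mathbb R^+\to\mathbb R^+$ with $\lim_{\eta\to0}\mathfrak a(\eta)=0$ and $\Omega:\mathbb R^d\to\mathbb R$ locally integrable such that $\Big|\int_{1\ge|u|\ge\eta^{1/(1+\beta)}}(u\cdot\sigma)[\mathrm{Im}\,\Phi_\eta(u)-\mathrm{Im}\,\Phi(u)]|u|_\eta^{-d-\alpha}du\Big|\le\mathfrak a(\eta)|\ln\eta|$ and $\mathrm{Im}\,\Phi(\lambda'\sigma')/(\lambda')^{1+\beta}\to\Omega(\sigma')$ in $L^1(\mathbb S^{d-1})$ (in the variable $\sigma'$) as $\lambda'\to0$, $\lambda'\neq0$; (ii-b) if $\alpha\in(-\beta,\beta]$, $\int_{|u|\ge1}|\Phi_\eta(u)|^2|u|_\eta^{-d-\alpha+\beta}du\lesssim1$.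
   Formalization: For α=0 the printed constant is corrected to μ₀(1+β)/(c_{0,β}|S^{d-1}|), as ∫M_β=1 makes c_{0,β}≠1 in general (1/π for d=β=1). The explicit rate is stated as a rate depending only on d, α, β, λ, ξ and the hypotheses' constants and rates. The (ln R)^{1/2} bound is required only for R≥2. *)

theory Defs
  imports "HOL-Analysis.Analysis"
begin

text \<open>
  Velocities live in \<open>real ^ 'n\<close> with dimension \<open>d = CARD('n)\<close>. The exponent \<open>\<alpha>\<close> is an
  extended real; \<open>\<alpha> = \<infinity>\<close> denotes the case of a rapidly decaying equilibrium.
  Elements of the weighted spaces are Borel representatives, equality being almost everywhere.
\<close>

section \<open>Weighted spaces\<close>

definition jap :: "real ^ 'n::finite \<Rightarrow> real" where
  "jap v = sqrt (1 + (norm v)\<^sup>2)"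

definition L2w :: "(real ^ 'n::finite \<Rightarrow> real) \<Rightarrow> real \<Rightarrow> (real ^ 'n \<Rightarrow> complex) set" where
  "L2w M k = {h. h \<in> borel_measurable borel \<and>
                 integrable lborel (\<lambda>v. (cmod (h v))\<^sup>2 * jap v powr k * M v)}"

definition normw :: "(real ^ 'n::finite \<Rightarrow> real) \<Rightarrow> real \<Rightarrow> (real ^ 'n \<Rightarrow> complex) \<Rightarrow> real" where
  "normw M k h = sqrt (\<integral>v. (cmod (h v))\<^sup>2 * jap v powr k * M v \<partial>lborel)"

definition scal :: "(real ^ 'n::finite \<Rightarrow> real) \<Rightarrow> (real ^ 'n \<Rightarrow> complex) \<Rightarrow> (real ^ 'n \<Rightarrow> complex) \<Rightarrow> complex" where
  "scal M g h = (\<integral>v. g v * cnj (h v) * of_real (M v) \<partial>lborel)"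

text \<open>The integral of \<open>h\<close> against \<open>M\<^sub>\<beta> = jap powr (-\<beta>) * M\<close>.\<close>

definition mean_beta :: "real \<Rightarrow> (real ^ 'n::finite \<Rightarrow> real) \<Rightarrow> (real ^ 'n \<Rightarrow> complex) \<Rightarrow> complex" where
  "mean_beta \<beta> M h = (\<integral>v. h v * of_real (jap v powr (-\<beta>) * M v) \<partial>lborel)"

text \<open>Surface measure of the unit sphere: \<open>d\<close> times the volume of the cone over a set
  (for \<open>d = 1\<close> this is the counting measure on \<open>{-1, 1}\<close>).\<close>

definition sphere_measure :: "(real ^ 'n::finite) measure" where
  "sphere_measure = scale_measure (ennreal (real CARD('n)))
     (distr (restrict_space lborel (ball 0 1 - {0})) borel sgn)"

definition sphere_area :: "'n::finite itself \<Rightarrow> real" where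
  "sphere_area _ = measure (sphere_measure :: (real ^ 'n) measure) UNIV"

fun Ck :: "nat \<Rightarrow> (real ^ 'n::finite \<Rightarrow> real) \<Rightarrow> bool" where
  "Ck 0 f = continuous_on UNIV f"
| "Ck (Suc k) f = ((\<forall>x. f differentiable (at x)) \<and>
      (\<forall>i\<in>Basis. Ck k (\<lambda>x. frechet_derivative f (at x) i)))"

definition smooth :: "(real ^ 'n::finite \<Rightarrow> real) \<Rightarrow> bool" where
  "smooth f \<longleftrightarrow> (\<forall>k. Ck k f)"


section \<open>Unbounded operators on \<open>L\<^sup>2(M)\<close>\<close>

definition lin_operator ::
  "(real ^ 'n::finite \<Rightarrow> real) \<Rightarrow> (real ^ 'n \<Rightarrow> complex) set \<Rightarrow>
   ((real ^ 'n \<Rightarrow> complex) \<Rightarrow> (real ^ 'n \<Rightarrow> complex)) \<Rightarrow> bool" where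
  "lin_operator M D A \<longleftrightarrow>
     D \<subseteq> L2w M 0 \<and> A ` D \<subseteq> L2w M 0 \<and> (\<lambda>_. 0) \<in> D \<and>
     (\<forall>h\<in>D. \<forall>g\<in>L2w M 0. (AE v in lborel. g v = h v) \<longrightarrow>
        g \<in> D \<and> (AE v in lborel. A g v = A h v)) \<and>
     (\<forall>g\<in>D. \<forall>h\<in>D. \<forall>a b. (\<lambda>v. a * g v + b * h v) \<in> D \<and>
        (AE v in lborel. A (\<lambda>w. a * g w + b * h w) v = a * A g v + b * A h v))"

definition densely_defined ::
  "(real ^ 'n::finite \<Rightarrow> real) \<Rightarrow> (real ^ 'n \<Rightarrow> complex) set \<Rightarrow> bool" where
  "densely_defined M D \<longleftrightarrow>
     (\<forall>h\<in>L2w M 0. \<forall>e>0. \<exists>g\<in>D. normw M 0 (\<lambda>v. h v - g v) < e)"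

definition closed_operator ::
  "(real ^ 'n::finite \<Rightarrow> real) \<Rightarrow> (real ^ 'n \<Rightarrow> complex) set \<Rightarrow>
   ((real ^ 'n \<Rightarrow> complex) \<Rightarrow> (real ^ 'n \<Rightarrow> complex)) \<Rightarrow> bool" where
  "closed_operator M D A \<longleftrightarrow>
     (\<forall>s h g. (\<forall>n::nat. s n \<in> D) \<longrightarrow> h \<in> L2w M 0 \<longrightarrow> g \<in> L2w M 0 \<longrightarrow>
        (\<lambda>n. normw M 0 (\<lambda>v. s n v - h v)) \<longlonglongrightarrow> 0 \<longrightarrow>
        (\<lambda>n. normw M 0 (\<lambda>v. A (s n) v - g v)) \<longlonglongrightarrow> 0 \<longrightarrow>
        h \<in> D \<and> (AE v in lborel. A h v = g v))"

definition rotation_invariant ::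
  "(real ^ 'n::finite \<Rightarrow> complex) set \<Rightarrow>
   ((real ^ 'n \<Rightarrow> complex) \<Rightarrow> (real ^ 'n \<Rightarrow> complex)) \<Rightarrow> bool" where
  "rotation_invariant D A \<longleftrightarrow>
     (\<forall>Q. rotation_matrix Q \<longrightarrow> (\<forall>h\<in>D. (\<lambda>v. h (Q *v v)) \<in> D \<and>
        (AE v in lborel. A (\<lambda>w. h (Q *v w)) v = A h (Q *v v))))"

text \<open>\<open>adjoint_maps M D A \<psi> w\<close>: \<open>\<psi>\<close> lies in the domain of the adjoint of \<open>(D, A)\<close> in
  \<open>L\<^sup>2(M)\<close> and is mapped to \<open>w\<close>.\<close>

definition adjoint_maps ::
  "(real ^ 'n::finite \<Rightarrow> real) \<Rightarrow> (real ^ 'n \<Rightarrow> complex) set \<Rightarrow>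
   ((real ^ 'n \<Rightarrow> complex) \<Rightarrow> (real ^ 'n \<Rightarrow> complex)) \<Rightarrow>
   (real ^ 'n \<Rightarrow> complex) \<Rightarrow> (real ^ 'n \<Rightarrow> complex) \<Rightarrow> bool" where
  "adjoint_maps M D A \<psi> w \<longleftrightarrow>
     \<psi> \<in> L2w M 0 \<and> w \<in> L2w M 0 \<and> (\<forall>g\<in>D. scal M (A g) \<psi> = scal M g w)"


section \<open>Constants, error terms and convergence rates of the hypotheses\<close>

text \<open>Every implicit constant and every rate of convergence in the hypotheses is a field of this
  record, so that a statement quantifying over all data satisfying the hypotheses with a
  given record is uniform in everything but these constants.
  Rates that need only be finite near \<open>0\<close> take values in \<open>ennreal\<close>.\<close>

record ('n) hyp_consts =
  decay_const :: "nat \<Rightarrow> real"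
  lv_const1 :: "real \<Rightarrow> real"
  lv_const2 :: real
  eta0 :: real
  small_r0 :: real
  theta_lower :: real
  theta_upper :: real
  mode_const :: real
  mu_rate :: "real \<Rightarrow> real"
  moment_const :: "real \<Rightarrow> real"
  eta1 :: real
  growth_exp :: real
  delta :: real
  growth_const :: real
  im_const :: real
  loc_rate :: "(real ^ 'n) set \<Rightarrow> real \<Rightarrow> ennreal"
  afrak :: "real \<Rightarrow> real"
  sphere_rate :: "real \<Rightarrow> ennreal"
  tail_const :: real


section \<open>Hypotheses\<close>

definition eq_const :: "'n::finite itself \<Rightarrow> real \<Rightarrow> real \<Rightarrow> real" where
  "eq_const _ a \<beta> = 1 / (\<integral>v. jap (v :: real ^ 'n) powr (- real CARD('n) - a - \<beta>) \<partial>lborel)"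

definition equilibrium ::
  "'n::finite hyp_consts \<Rightarrow> ereal \<Rightarrow> real \<Rightarrow> (real ^ 'n \<Rightarrow> real) \<Rightarrow> bool" where
  "equilibrium C \<alpha> \<beta> M \<longleftrightarrow>
     (if \<alpha> = \<infinity> then
        smooth M \<and> (\<forall>v. M v > 0) \<and> (\<forall>v w. norm v = norm w \<longrightarrow> M v = M w) \<and>
        (\<forall>k v. M v \<le> decay_const C k * jap v powr (- real k))
      else
        (\<forall>v. M v = eq_const TYPE('n) (real_of_ereal \<alpha>) \<beta> *
                     jap v powr (- (real CARD('n) + real_of_ereal \<alpha>)))) \<and>
     integrable lborel (\<lambda>v. jap v powr (-\<beta>) * M v) \<and>
     (\<integral>v. jap v powr (-\<beta>) * M v \<partial>lborel) = 1"

definition tilde_op ::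
  "real \<Rightarrow> ((real ^ 'n::finite \<Rightarrow> complex) \<Rightarrow> (real ^ 'n \<Rightarrow> complex)) \<Rightarrow>
   (real ^ 'n \<Rightarrow> complex) \<Rightarrow> (real ^ 'n \<Rightarrow> complex)" where
  "tilde_op \<beta> L g = (\<lambda>v. of_real (jap v powr (\<beta>/2)) * L (\<lambda>w. of_real (jap w powr (\<beta>/2)) * g w) v)"

text \<open>
  \<open>L\<close> is an operation on functions; \<open>DL\<close> is the domain of \<open>L\<close> and \<open>Dt\<close> that of
  \<open>tilde_op \<beta> L\<close>, both in \<open>L\<^sup>2(M)\<close>. The constant \<open>1\<close> need not lie in \<open>L\<^sup>2(M)\<close> (it does not when
  \<open>\<alpha> = 0\<close>), whereas \<open>jap powr (-\<beta>/2)\<close> always does. Hence \<open>L(1) = L\<^sup>*(1) = 0\<close> is expressed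
  through \<open>tilde_op \<beta> L\<close> and, whenever \<open>1 \<in> L\<^sup>2(M)\<close>, also literally.
\<close>

definition weighted_coercivity ::
  "real \<Rightarrow> real \<Rightarrow> (real ^ 'n::finite \<Rightarrow> real) \<Rightarrow>
   ((real ^ 'n \<Rightarrow> complex) \<Rightarrow> (real ^ 'n \<Rightarrow> complex)) \<Rightarrow>
   (real ^ 'n \<Rightarrow> complex) set \<Rightarrow> (real ^ 'n \<Rightarrow> complex) set \<Rightarrow> bool" where
  "weighted_coercivity \<beta> lam M L DL Dt \<longleftrightarrow>
     lin_operator M DL L \<and> closed_operator M DL L \<and> densely_defined M DL \<and>
     rotation_invariant DL L \<and>
     lin_operator M Dt (tilde_op \<beta> L) \<and> closed_operator M Dt (tilde_op \<beta> L) \<and>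
     densely_defined M Dt \<and> rotation_invariant Dt (tilde_op \<beta> L) \<and>
     (integrable lborel M \<longrightarrow>
        (\<lambda>_. 1) \<in> DL \<and> (AE v in lborel. L (\<lambda>_. 1) v = 0) \<and>
        adjoint_maps M DL L (\<lambda>_. 1) (\<lambda>_. 0)) \<and>
     (let w = (\<lambda>v. of_real (jap v powr (-\<beta>/2))) in
        w \<in> Dt \<and> (AE v in lborel. tilde_op \<beta> L w v = 0) \<and>
        adjoint_maps M Dt (tilde_op \<beta> L) w (\<lambda>_. 0) \<and>
        (\<forall>g\<in>Dt. scal M g w = 0 \<longrightarrow>
           - Re (scal M (tilde_op \<beta> L g) g) \<ge> lam * (normw M 0 g)\<^sup>2)) \<and>
     (\<forall>h\<in>DL. integrable lborel (\<lambda>v. h v * of_real (jap v powr (-\<beta>) * M v)) \<and>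
        (\<lambda>v. h v - mean_beta \<beta> M h) \<in> L2w M (-\<beta>) \<and>
        - Re (scal M (L h) h) \<ge> lam * (normw M (-\<beta>) (\<lambda>v. h v - mean_beta \<beta> M h))\<^sup>2)"

definition cutoff :: "(real ^ 'n::finite \<Rightarrow> real) \<Rightarrow> bool" where
  "cutoff chi \<longleftrightarrow> smooth chi \<and> (\<forall>v. 0 \<le> chi v \<and> chi v \<le> 1) \<and>
     (\<forall>v\<in>ball 0 1. chi v = 1) \<and> (\<forall>v. v \<notin> ball 0 2 \<longrightarrow> chi v = 0)"

definition cut :: "(real ^ 'n::finite \<Rightarrow> real) \<Rightarrow> real \<Rightarrow> real ^ 'n \<Rightarrow> complex" where
  "cut chi R v = of_real (chi ((1 / R) *\<^sub>R v))"

definition cut_tilde ::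
  "real \<Rightarrow> (real ^ 'n::finite \<Rightarrow> real) \<Rightarrow> real ^ 'n \<Rightarrow> real \<Rightarrow> real ^ 'n \<Rightarrow> complex" where
  "cut_tilde \<beta> chi \<sigma> R v = of_real ((v \<bullet> \<sigma>) * jap v powr \<beta>) * cut chi R v"

text \<open>
  The bound on \<open>L(cut chi R)\<close> is required with every real \<open>a \<le> \<alpha>\<close> in the exponent: since \<open>R \<ge> 1\<close>, for
  finite \<open>\<alpha>\<close> this amounts to the exponent \<open>-(\<alpha>+\<beta>)/2\<close>, and for \<open>\<alpha> = \<infinity>\<close> it means decay
  faster than any power of \<open>R\<close>. The logarithmic bound is only required for \<open>R \<ge> 2\<close>, because
  \<open>ln R\<close> vanishes at \<open>R = 1\<close>.
\<close>

definition large_velocity ::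
  "'n::finite hyp_consts \<Rightarrow> ereal \<Rightarrow> real \<Rightarrow> (real ^ 'n \<Rightarrow> real) \<Rightarrow>
   ((real ^ 'n \<Rightarrow> complex) \<Rightarrow> (real ^ 'n \<Rightarrow> complex)) \<Rightarrow> (real ^ 'n \<Rightarrow> complex) set \<Rightarrow>
   (real ^ 'n \<Rightarrow> real) \<Rightarrow> bool" where
  "large_velocity C \<alpha> \<beta> M L DL chi \<longleftrightarrow>
     cutoff chi \<and>
     (\<forall>R\<ge>1. cut chi R \<in> DL \<and> L (cut chi R) \<in> L2w M \<beta> \<and>
        (\<forall>a. ereal a \<le> \<alpha> \<longrightarrow>
           normw M \<beta> (L (cut chi R)) \<le> lv_const1 C a * R powr (- (a + \<beta>) / 2))) \<and>
     (\<alpha> < ereal (2 + \<beta>) \<longrightarrow>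
        (\<forall>R\<ge>1. \<forall>\<sigma>\<in>sphere 0 1. cut_tilde \<beta> chi \<sigma> R \<in> DL \<and> L (cut_tilde \<beta> chi \<sigma> R) \<in> L2w M \<beta> \<and>
           normw M \<beta> (L (cut_tilde \<beta> chi \<sigma> R))
             \<le> lv_const2 C * R powr (1 + \<beta> - (real_of_ereal \<alpha> + \<beta>) / 2))) \<and>
     (\<alpha> = ereal (2 + \<beta>) \<longrightarrow>
        (\<forall>R\<ge>2. \<forall>\<sigma>\<in>sphere 0 1. cut_tilde \<beta> chi \<sigma> R \<in> DL \<and> L (cut_tilde \<beta> chi \<sigma> R) \<in> L2w M \<beta> \<and>
           normw M \<beta> (L (cut_tilde \<beta> chi \<sigma> R)) \<le> lv_const2 C * sqrt (ln R)))"

definition Theta :: "ereal \<Rightarrow> real \<Rightarrow> real \<Rightarrow> real" where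
  "Theta \<alpha> \<beta> \<eta> =
     (if \<alpha> > ereal (2 + \<beta>) then \<eta>\<^sup>2
      else if \<alpha> = ereal (2 + \<beta>) then \<eta>\<^sup>2 * \<bar>ln \<eta>\<bar>
      else \<eta> powr ((real_of_ereal \<alpha> + \<beta>) / (1 + \<beta>)))"

text \<open>
  \<open>-L\<^sup>*\<phi> - i\<eta>(v\<cdot>\<sigma>)\<phi> = z jap powr (-\<beta>) \<phi>\<close> for \<open>\<phi> \<in> L\<^sup>2(jap powr (-\<beta>) M)\<close>, which in general is not an
  element of \<open>L\<^sup>2(M)\<close>. Multiplied by \<open>jap powr (\<beta>/2)\<close>, it becomes the eigenvalue equation
  \<open>(-tilde L + i\<eta>(v\<cdot>\<sigma>) jap powr \<beta>)\<^sup>* \<psi> = z \<psi>\<close> in \<open>L\<^sup>2(M)\<close> for \<open>\<psi> = jap powr (-\<beta>/2) \<phi>\<close>, the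
  operator being defined on the intersection of the domains of its two summands.
\<close>

definition fluid_equation ::
  "real \<Rightarrow> (real ^ 'n::finite \<Rightarrow> real) \<Rightarrow>
   ((real ^ 'n \<Rightarrow> complex) \<Rightarrow> (real ^ 'n \<Rightarrow> complex)) \<Rightarrow> (real ^ 'n \<Rightarrow> complex) set \<Rightarrow>
   real \<Rightarrow> real ^ 'n \<Rightarrow> (real ^ 'n \<Rightarrow> complex) \<Rightarrow> complex \<Rightarrow> bool" where
  "fluid_equation \<beta> M L Dt \<eta> \<sigma> \<phi> z \<longleftrightarrow>
     (let \<psi> = (\<lambda>v. of_real (jap v powr (-\<beta>/2)) * \<phi> v);
          T = (\<lambda>g v. of_real ((v \<bullet> \<sigma>) * jap v powr \<beta>) * g v)
      in adjoint_maps M {g \<in> Dt. T g \<in> L2w M 0}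
           (\<lambda>g v. - tilde_op \<beta> L g v + \<i> * of_real \<eta> * T g v) \<psi> (\<lambda>v. z * \<psi> v))"

definition is_fluid_pair ::
  "real \<Rightarrow> (real ^ 'n::finite \<Rightarrow> real) \<Rightarrow>
   ((real ^ 'n \<Rightarrow> complex) \<Rightarrow> (real ^ 'n \<Rightarrow> complex)) \<Rightarrow> (real ^ 'n \<Rightarrow> complex) set \<Rightarrow>
   real \<Rightarrow> real \<Rightarrow> real ^ 'n \<Rightarrow> (real ^ 'n \<Rightarrow> complex) \<Rightarrow> complex \<Rightarrow> bool" where
  "is_fluid_pair \<beta> M L Dt r0 \<eta> \<sigma> \<phi> z \<longleftrightarrow>
     \<phi> \<in> L2w M (-\<beta>) \<and> z \<in> ball 0 r0 \<and> fluid_equation \<beta> M L Dt \<eta> \<sigma> \<phi> z \<and>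
     mean_beta \<beta> M \<phi> = 1"

text \<open>\<open>\<phi> \<eta> \<sigma>\<close> and \<open>\<mu> \<eta>\<close> are the fluid mode (unique in a complex ball of eigenvalues, up to null sets),
  and \<open>\<mu>0\<close> is the constant in \<open>\<mu>(\<eta>) \<sim> \<mu>0 \<Theta>(\<eta>)\<close>.\<close>

definition fluid_mode ::
  "'n::finite hyp_consts \<Rightarrow> ereal \<Rightarrow> real \<Rightarrow> real \<Rightarrow> (real ^ 'n \<Rightarrow> real) \<Rightarrow>
   ((real ^ 'n \<Rightarrow> complex) \<Rightarrow> (real ^ 'n \<Rightarrow> complex)) \<Rightarrow> (real ^ 'n \<Rightarrow> complex) set \<Rightarrow>
   (real \<Rightarrow> real ^ 'n \<Rightarrow> real ^ 'n \<Rightarrow> complex) \<Rightarrow> (real \<Rightarrow> real) \<Rightarrow> real \<Rightarrow> bool" where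
  "fluid_mode C \<alpha> \<beta> lam M L Dt \<phi> \<mu> \<mu>0 \<longleftrightarrow>
     eta0 C > 0 \<and> 0 < small_r0 C \<and> small_r0 C < lam \<and>
     0 < theta_lower C \<and> theta_lower C < theta_upper C \<and>
     (\<forall>\<eta>\<in>{0<..<eta0 C}. \<forall>\<sigma>\<in>sphere 0 1.
        is_fluid_pair \<beta> M L Dt (small_r0 C) \<eta> \<sigma> (\<phi> \<eta> \<sigma>) (of_real (\<mu> \<eta>)) \<and>
        (\<forall>\<phi>' z. is_fluid_pair \<beta> M L Dt (small_r0 C) \<eta> \<sigma> \<phi>' z \<longrightarrow>
           z = of_real (\<mu> \<eta>) \<and> (AE v in lborel. \<phi>' v = \<phi> \<eta> \<sigma> v)) \<and>
        \<mu> \<eta> > 0 \<and>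
        normw M (-\<beta>) (\<lambda>v. \<phi> \<eta> \<sigma> v - 1) \<le> mode_const C * sqrt (\<mu> \<eta>) \<and>
        theta_lower C * Theta \<alpha> \<beta> \<eta> < \<mu> \<eta> \<and> \<mu> \<eta> < theta_upper C * Theta \<alpha> \<beta> \<eta>) \<and>
     theta_lower C < \<mu>0 \<and> \<mu>0 < theta_upper C \<and>
     (mu_rate C \<longlongrightarrow> 0) (at_right 0) \<and>
     (\<forall>\<eta>\<in>{0<..<eta0 C}. \<bar>\<mu> \<eta> / Theta \<alpha> \<beta> \<eta> - \<mu>0\<bar> \<le> mu_rate C \<eta>)"

definition eta_abs :: "real \<Rightarrow> real \<Rightarrow> real ^ 'n::finite \<Rightarrow> real" where
  "eta_abs \<beta> \<eta> u = sqrt (\<eta> powr (2 / (1 + \<beta>)) + (norm u)\<^sup>2)"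

definition rescaled ::
  "real \<Rightarrow> (real \<Rightarrow> real ^ 'n::finite \<Rightarrow> real ^ 'n \<Rightarrow> complex) \<Rightarrow>
   real \<Rightarrow> real ^ 'n \<Rightarrow> real ^ 'n \<Rightarrow> complex" where
  "rescaled \<beta> \<phi> \<eta> \<sigma> u = \<phi> \<eta> \<sigma> ((\<eta> powr (- 1 / (1 + \<beta>))) *\<^sub>R u)"

text \<open>All bounds are uniform in \<open>\<sigma>\<close>; \<open>\<Phi> \<sigma>\<close> is the limit of the rescaled mode, and \<open>\<Omega> \<sigma>\<close> its
  angular profile at the origin.\<close>

definition mode_scaling ::
  "'n::finite hyp_consts \<Rightarrow> ereal \<Rightarrow> real \<Rightarrow> (real ^ 'n \<Rightarrow> real) \<Rightarrow>
   (real \<Rightarrow> real ^ 'n \<Rightarrow> real ^ 'n \<Rightarrow> complex) \<Rightarrow> (real \<Rightarrow> real) \<Rightarrow>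
   (real ^ 'n \<Rightarrow> real ^ 'n \<Rightarrow> complex) \<Rightarrow> (real ^ 'n \<Rightarrow> real ^ 'n \<Rightarrow> real) \<Rightarrow> bool" where
  "mode_scaling C \<alpha> \<beta> M \<phi> \<mu> \<Phi> \<Omega> \<longleftrightarrow>
     (\<alpha> > ereal (2 + \<beta>) \<longrightarrow>
        (\<forall>l. ereal l < \<alpha> \<longrightarrow> (\<forall>\<eta>\<in>{0<..<eta0 C}. \<forall>\<sigma>\<in>sphere 0 1.
           \<phi> \<eta> \<sigma> \<in> L2w M l \<and> normw M l (\<phi> \<eta> \<sigma>) \<le> moment_const C l))) \<and>
     (\<alpha> \<le> ereal (2 + \<beta>) \<longrightarrow>
        (let a = real_of_ereal \<alpha>; d = real CARD('n); \<Phi>\<eta> = rescaled \<beta> \<phi> in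
        0 < eta1 C \<and> eta1 C < eta0 C \<and> growth_exp C > 0 \<and>
        delta C < \<beta> + min (2 - a) 1 \<and>
        (\<forall>K. compact K \<longrightarrow> 0 \<notin> K \<longrightarrow> (loc_rate C K \<longlongrightarrow> 0) (at_right 0)) \<and>
        (\<forall>\<sigma>\<in>sphere 0 1.
           \<Phi> \<sigma> \<in> borel_measurable borel \<and>
           (\<forall>K. compact K \<longrightarrow> 0 \<notin> K \<longrightarrow>
              set_integrable lborel K (\<lambda>u. (cmod (\<Phi> \<sigma> u))\<^sup>2) \<and>
              (\<forall>\<eta>\<in>{0<..<eta1 C}.
                 (\<integral>\<^sup>+u\<in>K. ennreal ((cmod (\<Phi>\<eta> \<eta> \<sigma> u - \<Phi> \<sigma> u))\<^sup>2) \<partial>lborel) \<le> loc_rate C K \<eta>)) \<and>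
           (\<forall>\<eta>\<in>{0<..<eta1 C}. AE u in lborel.
              cmod (\<Phi>\<eta> \<eta> \<sigma> u) \<le> growth_const C * eta_abs \<beta> \<eta> u powr (growth_exp C * \<mu> \<eta>) \<and>
              \<bar>Im (\<Phi>\<eta> \<eta> \<sigma> u)\<bar> \<le> im_const C * eta_abs \<beta> \<eta> u powr (\<beta> + min a 1 - delta C))) \<and>
        (\<alpha> = ereal (2 + \<beta>) \<longrightarrow>
           (\<forall>\<eta>>0. 0 \<le> afrak C \<eta>) \<and> (afrak C \<longlongrightarrow> 0) (at_right 0) \<and>
           (sphere_rate C \<longlongrightarrow> 0) (at_right 0) \<and>
           (\<forall>\<sigma>\<in>sphere 0 1.
              (\<forall>\<eta>\<in>{0<..<eta1 C}.
                 \<bar>LINT u:{u. \<eta> powr (1 / (1 + \<beta>)) \<le> norm u \<and> norm u \<le> 1}|lborel.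
                    (u \<bullet> \<sigma>) * (Im (\<Phi>\<eta> \<eta> \<sigma> u) - Im (\<Phi> \<sigma> u)) * eta_abs \<beta> \<eta> u powr (- d - a)\<bar>
                 \<le> afrak C \<eta> * \<bar>ln \<eta>\<bar>) \<and>
              \<Omega> \<sigma> \<in> borel_measurable borel \<and>
              (\<forall>K. compact K \<longrightarrow> set_integrable lborel K (\<Omega> \<sigma>)) \<and>
              (\<forall>s>0. (\<integral>\<^sup>+\<sigma>'. ennreal \<bar>Im (\<Phi> \<sigma> (s *\<^sub>R \<sigma>')) / s powr (1 + \<beta>) - \<Omega> \<sigma> \<sigma>'\<bar>
                       \<partial>sphere_measure) \<le> sphere_rate C s))) \<and>
        (\<alpha> \<le> ereal \<beta> \<longrightarrow>
           (\<forall>\<eta>\<in>{0<..<eta1 C}. \<forall>\<sigma>\<in>sphere 0 1.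
              (\<integral>\<^sup>+u\<in>{u. norm u \<ge> 1}. ennreal ((cmod (\<Phi>\<eta> \<eta> \<sigma> u))\<^sup>2 *
                 eta_abs \<beta> \<eta> u powr (- d - a + \<beta>)) \<partial>lborel) \<le> ennreal (tail_const C)))))"


section \<open>Diffusion exponent, time scale and diffusion coefficient\<close>

definition zeta :: "ereal \<Rightarrow> real \<Rightarrow> real" where
  "zeta \<alpha> \<beta> = (if \<alpha> \<ge> ereal (2 + \<beta>) then 2 else (real_of_ereal \<alpha> + \<beta>) / (1 + \<beta>))"

definition theta :: "ereal \<Rightarrow> real \<Rightarrow> real \<Rightarrow> real" where
  "theta \<alpha> \<beta> \<epsilon> =
     (if \<alpha> = 0 then \<epsilon> powr (\<beta> / (1 + \<beta>)) / \<bar>ln \<epsilon>\<bar>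
      else if \<alpha> = ereal (2 + \<beta>) then \<epsilon>\<^sup>2 * \<bar>ln \<epsilon>\<bar>
      else \<epsilon> powr (zeta \<alpha> \<beta>))"

definition diffusion_quotient ::
  "ereal \<Rightarrow> real \<Rightarrow> (real ^ 'n::finite \<Rightarrow> real) \<Rightarrow>
   (real \<Rightarrow> real ^ 'n \<Rightarrow> real ^ 'n \<Rightarrow> complex) \<Rightarrow> (real \<Rightarrow> real) \<Rightarrow>
   real ^ 'n \<Rightarrow> real \<Rightarrow> complex" where
  "diffusion_quotient \<alpha> \<beta> M \<phi> \<mu> \<xi> \<epsilon> =
     of_real (\<mu> (\<epsilon> * norm \<xi>) * norm \<xi> powr (- zeta \<alpha> \<beta>)) /
     (of_real (theta \<alpha> \<beta> \<epsilon>) * scal M (\<lambda>_. 1) (\<phi> (\<epsilon> * norm \<xi>) (sgn \<xi>)))"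

text \<open>
  For \<open>\<alpha> = 0\<close> one has \<open>M v = c * jap v powr (-d)\<close> with \<open>c = eq_const TYPE('n) 0 \<beta>\<close>, and
  \<open>\<langle>1, \<phi>\<^sub>\<eta>\<rangle> \<sim> c * sphere_area TYPE('n) / (1 + \<beta>) * \<bar>ln \<eta>\<bar>\<close>. The factor \<open>c\<close> is therefore part of the
  coefficient: \<open>c \<noteq> 1\<close> in
  general, as it is fixed by the unit mass of \<open>jap powr (-\<beta>) * M\<close>.
\<close>

definition kappa :: "ereal \<Rightarrow> real \<Rightarrow> (real ^ 'n::finite \<Rightarrow> real) \<Rightarrow> real \<Rightarrow> real" where
  "kappa \<alpha> \<beta> M \<mu>0 =
     \<mu>0 * (if \<alpha> > 0 then 1 / (\<integral>v. \<bar>M v\<bar> \<partial>lborel)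
           else (1 + \<beta>) / (eq_const TYPE('n) 0 \<beta> * sphere_area TYPE('n)))"

end

theory Submission
  imports Defs "HOL-Real_Asymp.Real_Asymp"
begin

text \<open>
  Write the quotient as \<open>(\<mu>/\<Theta>) * r / (\<langle>1, \<phi>\<rangle> / l)\<close>, where \<open>l = 1\<close> for \<open>\<alpha> > 0\<close>, \<open>l = \<bar>ln \<eta>\<bar>\<close> for \<open>\<alpha> = 0\<close>,
  and \<open>r \<rightarrow> 1\<close> depends only on the exponents. It remains to find the limit of
  \<open>\<langle>1, \<phi>\<rangle> / l\<close>, uniformly over all data with the given constants.
  Since \<open>\<parallel>\<phi> - 1\<parallel>\<close> in the weight \<open>-\<beta>\<close> is \<open>O(\<mu>\<^bsup>1/2\<^esup>)\<close>, the Cauchy-Schwarz inequality against the weight \<open>\<beta>\<close> suffices on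
  all of space when \<open>\<alpha> > \<beta>\<close>, and on balls in general. For \<open>0 < \<alpha> \<le> \<beta>\<close>, outside a large fixed ball the growth
  bound dominates \<open>\<phi>\<close> by \<open>jap powr (\<alpha>/2)\<close>, which is integrable against \<open>M\<close>. For \<open>\<alpha> = 0\<close> the ball has
  radius \<open>\<eta> powr (-1/(1+\<beta>))\<close>: the tail bound makes the outside contribution \<open>O(1)\<close>, the error
  inside is \<open>O(\<bar>ln \<eta>\<bar>\<^bsup>1/2\<^esup>)\<close>, and the mass of \<open>M\<close> on the ball is asymptotic to
  \<open>c * \<bar>S\<bar> * \<bar>ln \<eta>\<bar> / (1+\<beta>)\<close>, where \<open>\<bar>S\<bar>\<close> is the area of the unit sphere and \<open>M = c * jap powr (-d)\<close>.
\<close>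

section \<open>Radial integrals\<close>

text \<open>Polar coordinates for radial integrands follow from the volumes of balls alone, because
  two measures on the line that agree and are finite on all half-lines \<open>{x<..}\<close>
  coincide. The radius carries a minus sign so that the preimage of \<open>{x<..}\<close> is a ball,
  of finite volume, and not the complement of one.\<close>

lemma nn_integral_radial:
  fixes f :: "real \<Rightarrow> ennreal"
  assumes [measurable]: "f \<in> borel_measurable borel"
  shows "(\<integral>\<^sup>+(v::'a::euclidean_space). f (norm v) \<partial>lborel) =
    (\<integral>\<^sup>+r. f r * (ennreal (DIM('a) * unit_ball_vol (DIM('a)) * r ^ (DIM('a) - 1)) * indicator {0..} r) \<partial>lborel)"
proof -
  define w where "w = unit_ball_vol (real DIM('a))"
  have w: "w \<ge> 0" unfolding w_def by simp
  define h :: "real \<Rightarrow> ennreal" where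
    "h = (\<lambda>r. ennreal (DIM('a) * w * (- r) ^ (DIM('a) - 1)) * indicator {..0} r)"
  have [measurable]: "h \<in> borel_measurable borel" unfolding h_def by measurable
  have eq: "distr lborel borel (\<lambda>v::'a. - norm v) = density lborel h"
  proof (rule measure_eqI_lessThan)
    fix x :: real
    have "emeasure (distr lborel borel (\<lambda>v::'a. - norm v)) {x<..} = emeasure lborel (ball (0::'a) (- x))"
      by (subst emeasure_distr) (auto intro!: arg_cong[where f="emeasure lborel"])
    also have "\<dots> = (if x \<le> 0 then ennreal (w * (- x) ^ DIM('a)) else 0)"
      by (cases "x \<le> 0") (auto simp: emeasure_ball ball_empty w_def)
    finally have 1: "emeasure (distr lborel borel (\<lambda>v::'a. - norm v)) {x<..} =
      (if x \<le> 0 then ennreal (w * (- x) ^ DIM('a)) else 0)" .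
    then show "emeasure (distr lborel borel (\<lambda>v::'a. - norm v)) {x<..} < \<infinity>" by simp
    have "emeasure (density lborel h) {x<..} = (\<integral>\<^sup>+r. h r * indicator {x<..} r \<partial>lborel)"
      by (subst emeasure_density) auto
    also have "\<dots> = (if x \<le> 0 then ennreal (w * (- x) ^ DIM('a)) else 0)"
    proof (cases "x \<le> 0")
      case True
      have "(\<integral>\<^sup>+r. h r * indicator {x<..} r \<partial>lborel) =
        (\<integral>\<^sup>+r. ennreal (DIM('a) * w * (- r) ^ (DIM('a) - 1)) * indicator {x..0} r \<partial>lborel)"
      proof (rule nn_integral_cong_AE)
        show "AE r in lborel. h r * indicator {x<..} r =
          ennreal (DIM('a) * w * (- r) ^ (DIM('a) - 1)) * indicator {x..0} r"
          using AE_lborel_singleton[of x] by eventually_elim (auto simp: h_def split: split_indicator)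
      qed
      \<comment> \<open>The antiderivative is \<open>- w * (- r) ^ DIM('a)\<close>; it vanishes at 0
        since the dimension is positive.\<close>
      also have "\<dots> = ennreal (- w * (- 0) ^ DIM('a) - (- w * (- x) ^ DIM('a)))"
        using w True
        by (intro nn_integral_FTC_Icc) (auto intro!: derivative_eq_intros mult_nonneg_nonneg)
      finally show ?thesis using True by (simp add: power_0_left)
    next
      case False
      then have "h r * indicator {x<..} r = 0" for r
        by (auto simp: h_def split: split_indicator)
      then show ?thesis using False by (simp del: mult_eq_0_iff)
    qed
    finally show "emeasure (distr lborel borel (\<lambda>v::'a. - norm v)) {x<..} =
      emeasure (density lborel h) {x<..}" using 1 by simp
  qed auto
  have "(\<integral>\<^sup>+(v::'a). f (norm v) \<partial>lborel) = (\<integral>\<^sup>+r. f (- r) \<partial>distr lborel borel (\<lambda>v::'a. - norm v))"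
    by (subst nn_integral_distr) auto
  also have "\<dots> = (\<integral>\<^sup>+r. h r * f (- r) \<partial>lborel)"
    unfolding eq by (subst nn_integral_density) auto
  also have "\<dots> = (\<integral>\<^sup>+r. h (- r) * f r \<partial>lborel)"
    by (subst nn_integral_real_affine[where c="-1" and t=0]) auto
  also have "\<dots> = (\<integral>\<^sup>+r. f r * (ennreal (DIM('a) * w * r ^ (DIM('a) - 1)) * indicator {0..} r) \<partial>lborel)"
    by (intro nn_integral_cong) (auto simp: h_def mult.commute split: split_indicator)
  finally show ?thesis unfolding w_def .
qed

section \<open>Elementary properties of the Japanese bracket\<close>

lemma one_le_jap: "1 \<le> jap v" and jap_pos: "0 < jap v" and norm_le_jap: "norm v \<le> jap v"
proof -
  show 1: "1 \<le> jap v" unfolding jap_def by (simp add: real_le_rsqrt)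
  then show "0 < jap v" by linarith
  show "norm v \<le> jap v" unfolding jap_def by (rule real_le_rsqrt) simp
qed

lemma jap_le: "norm v \<le> R \<Longrightarrow> 1 \<le> R \<Longrightarrow> jap v \<le> 2 * R"
  unfolding jap_def by (rule real_le_lsqrt) (auto simp: power_mult_distrib intro!: order.trans[OF add_mono[OF one_le_power[of R 2] power_mono[of "norm v" R 2]]])

lemma borel_measurable_jap [measurable]: "jap \<in> borel_measurable borel"
  unfolding jap_def[abs_def] by measurable

lemma continuous_on_jap_powr: "continuous_on S (\<lambda>v. jap v powr p)"
proof -
  have "continuous_on S jap" unfolding jap_def[abs_def] by (intro continuous_intros)
  then show ?thesis by (rule continuous_on_powr) (auto simp: continuous_on_const jap_pos[THEN less_imp_neq, symmetric])
qed

section \<open>Area of the sphere and integrals of powers of the bracket\<close>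

text \<open>The cone over the whole sphere is the punctured unit ball, and the missing centre has no
  volume.\<close>

lemma sphere_area_eq: "sphere_area TYPE('n::finite) = CARD('n) * unit_ball_vol (CARD('n))"
proof -
  have sub: "ball 0 1 - {0} \<in> sets (lborel :: (real ^ 'n) measure)" by simp
  have "emeasure (distr (restrict_space lborel (ball 0 1 - {0})) borel (sgn :: real ^ 'n \<Rightarrow> _)) UNIV =
    emeasure (lborel :: (real ^ 'n) measure) (ball 0 1 - {0})"
    using sub
    by (subst emeasure_distr)
       (auto simp: space_restrict_space emeasure_restrict_space intro!: measurable_restrict_space1)
  also have "\<dots> = emeasure (lborel :: (real ^ 'n) measure) (ball 0 1)"
    by (subst emeasure_Diff) auto
  also have "\<dots> = ennreal (unit_ball_vol (CARD('n)))" by (simp add: emeasure_ball)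
  finally show ?thesis
    unfolding sphere_area_def sphere_measure_def
    by (simp add: measure_def enn2real_mult)
qed

lemma sphere_area_pos: "sphere_area TYPE('n::finite) > 0"
  by (simp add: sphere_area_eq)

lemma nn_integral_radial_sphere_area:
  fixes f :: "real \<Rightarrow> ennreal"
  assumes [measurable]: "f \<in> borel_measurable borel"
  shows "(\<integral>\<^sup>+(v::real^'n::finite). f (norm v) \<partial>lborel) =
    ennreal (sphere_area TYPE('n)) * (\<integral>\<^sup>+r. f r * ennreal (r ^ (CARD('n) - 1)) * indicator {0..} r \<partial>lborel)"
  by (subst nn_integral_cmult[symmetric], measurable, subst nn_integral_radial, measurable)
     (auto intro!: nn_integral_cong simp: sphere_area_eq ennreal_mult ennreal_mult' mult_ac split: split_indicator)

text \<open>The exponent is negative and \<open>norm v \<le> jap v\<close>, so the bracket may be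
  replaced by the norm. In polar coordinates the integrand becomes
  \<open>r powr (- \<gamma> - 1)\<close>, whose integral from \<open>R\<close> to infinity is
  explicit.\<close>

lemma nn_integral_jap_tail_le:
  assumes "\<gamma> > 0" "R > 0"
  shows "(\<integral>\<^sup>+(v::real^'n::finite). ennreal (jap v powr (- real CARD('n) - \<gamma>)) * indicator (- ball 0 R) v \<partial>lborel)
    \<le> ennreal (sphere_area TYPE('n) / \<gamma> * R powr (- \<gamma>))"
proof -
  let ?d = "real CARD('n)"
  have "(\<integral>\<^sup>+(v::real^'n). ennreal (jap v powr (- ?d - \<gamma>)) * indicator (- ball 0 R) v \<partial>lborel)
     \<le> (\<integral>\<^sup>+(v::real^'n). ennreal (norm v powr (- ?d - \<gamma>)) * indicator {R..} (norm v) \<partial>lborel)"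
    using assms
    by (intro nn_integral_mono) (auto split: split_indicator intro!: ennreal_leI powr_mono2' norm_le_jap)
  also have "\<dots> = ennreal (sphere_area TYPE('n)) *
      (\<integral>\<^sup>+r. ennreal (r powr (- ?d - \<gamma>)) * indicator {R..} r * ennreal (r ^ (CARD('n) - 1)) * indicator {0..} r \<partial>lborel)"
    by (rule nn_integral_radial_sphere_area) measurable
  also have "(\<integral>\<^sup>+r. ennreal (r powr (- ?d - \<gamma>)) * indicator {R..} r * ennreal (r ^ (CARD('n) - 1)) * indicator {0..} r \<partial>lborel)
    = (\<integral>\<^sup>+r. ennreal (r powr (- \<gamma> - 1)) * indicator {R..} r \<partial>lborel)"
  proof (intro nn_integral_cong)
    fix r :: real
    have "r powr (- ?d - \<gamma>) * r ^ (CARD('n) - 1) = r powr (- \<gamma> - 1)" if "r \<ge> R"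
    proof -
      have "r ^ (CARD('n) - 1) = r powr (?d - 1)"
        using that assms by (subst powr_realpow[symmetric]) (auto simp: of_nat_diff Suc_leI)
      then show ?thesis by (simp add: powr_add[symmetric])
    qed
    then show "ennreal (r powr (- ?d - \<gamma>)) * indicator {R..} r * ennreal (r ^ (CARD('n) - 1)) * indicator {0..} r
      = ennreal (r powr (- \<gamma> - 1)) * indicator {R..} r"
      using assms by (auto simp: ennreal_mult'[symmetric] split: split_indicator)
  qed
  also have "\<dots> = ennreal (0 - (- (R powr (- \<gamma>)) / \<gamma>))"
  proof (rule nn_integral_FTC_atLeast)
    have "((\<lambda>r. r powr (- \<gamma>)) \<longlongrightarrow> 0) at_top"
      using assms by (intro tendsto_neg_powr filterlim_ident) auto
    then show "((\<lambda>r. - (r powr (- \<gamma>)) / \<gamma>) \<longlongrightarrow> 0) at_top"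
      using tendsto_divide[OF tendsto_minus tendsto_const, of _ 0 at_top \<gamma>] assms by auto
    show "((\<lambda>r. - (r powr (- \<gamma>)) / \<gamma>) has_real_derivative x powr (- \<gamma> - 1)) (at x)" if "R \<le> x" for x
      using that assms by (auto intro!: derivative_eq_intros simp: field_simps)
  qed auto
  finally show ?thesis
    using assms sphere_area_pos[where 'n='n] by (simp add: ennreal_mult'[symmetric])
qed

text \<open>The integrand is at most 1 on the unit ball; outside it the tail estimate applies with
  \<open>\<gamma> = - p - d\<close>, where \<open>d = CARD('n)\<close>.\<close>

lemma integrable_jap_powr:
  assumes "p < - real CARD('n)"
  shows "integrable lborel (\<lambda>v::real^'n::finite. jap v powr p)"
proof (rule integrableI_bounded)
  have "(\<integral>\<^sup>+(v::real^'n). ennreal (norm (jap v powr p)) \<partial>lborel) \<le>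
    (\<integral>\<^sup>+(v::real^'n). indicator (ball 0 1) v + ennreal (jap v powr p) * indicator (- ball 0 1) v \<partial>lborel)"
  proof (intro nn_integral_mono)
    fix v :: "real^'n"
    have "jap v powr p \<le> 1 powr p" using assms one_le_jap[of v] by (intro powr_mono2') auto
    then show "ennreal (norm (jap v powr p)) \<le> indicator (ball 0 1) v + ennreal (jap v powr p) * indicator (- ball 0 1) v"
      by (auto split: split_indicator)
  qed
  also have "\<dots> = emeasure lborel (ball (0::real^'n) 1) +
     (\<integral>\<^sup>+(v::real^'n). ennreal (jap v powr p) * indicator (- ball 0 1) v \<partial>lborel)"
    by (subst nn_integral_add) (auto intro!: borel_measurable_indicator)
  also have "\<dots> < \<infinity>"
    using emeasure_lborel_ball_finite[of "0::real^'n" 1]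
      nn_integral_jap_tail_le[of "- p - real CARD('n)" 1, where 'n='n] assms
    by (auto intro: le_less_trans[OF _ ennreal_less_top])
  finally show "(\<integral>\<^sup>+(v::real^'n). ennreal (norm (jap v powr p)) \<partial>lborel) < \<infinity>" .
qed measurable

lemma integral_jap_tail_le:
  assumes "\<gamma> > 0" "R > 0"
  shows "(\<integral>(v::real^'n::finite). jap v powr (- real CARD('n) - \<gamma>) * indicator (- ball 0 R) v \<partial>lborel)
    \<le> sphere_area TYPE('n) / \<gamma> * R powr (- \<gamma>)"
proof (rule integral_real_bounded)
  show "(\<integral>\<^sup>+(v::real^'n). ennreal (jap v powr (- real CARD('n) - \<gamma>) * indicator (- ball 0 R) v) \<partial>lborel)
     \<le> ennreal (sphere_area TYPE('n) / \<gamma> * R powr (- \<gamma>))"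
    using nn_integral_jap_tail_le[OF assms, where 'n='n]
    by (simp add: ennreal_mult'' ennreal_indicator)
qed (use assms sphere_area_pos[where 'n='n] in simp)

lemma integrable_jap_ball: "integrable lborel (\<lambda>v::real^'n::finite. jap v powr p * indicator (ball 0 R) v)"
proof -
  have "set_integrable lborel (cball (0::real^'n) R) (\<lambda>v. jap v powr p)"
    unfolding set_integrable_def by (intro borel_integrable_compact continuous_on_jap_powr) auto
  then have "set_integrable lborel (ball (0::real^'n) R) (\<lambda>v. jap v powr p)"
    by (rule set_integrable_subset) auto
  then show ?thesis by (simp add: set_integrable_def mult.commute)
qed

section \<open>Logarithmic growth of the critical power on balls\<close>

text \<open>A Bernoulli inequality for negative exponents, from \<open>ln (1 + x) \<le> x\<close>
  and \<open>1 + t \<le> exp t\<close>.\<close>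

lemma one_minus_le_powr_minus:
  fixes p x :: real
  assumes "p \<ge> 0" "x \<ge> 0"
  shows "1 - p * x \<le> (1 + x) powr (- p)"
proof -
  have "1 - p * x \<le> 1 + - p * ln (1 + x)"
    using ln_add_one_self_le_self[of x] assms by (simp add: mult_left_mono)
  also have "\<dots> \<le> exp (- p * ln (1 + x))" by (rule exp_ge_add_one_self)
  also have "\<dots> = (1 + x) powr (- p)" using assms by (simp add: powr_def)
  finally show ?thesis .
qed

text \<open>With \<open>r = norm v\<close> the bracket is
  \<open>r * (1 + r powr (- 2)) powr (1/2)\<close>, so the Bernoulli inequality gains two powers of
  decay. For \<open>p = d\<close> the difference is therefore integrable at infinity, although
  neither of its terms is. The factor \<open>2 powr (p + 2)\<close> comes from
  \<open>jap v \<le> 2 * norm v\<close>.\<close>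

lemma norm_powr_diff_jap_powr_le:
  fixes v :: "real^'n::finite"
  assumes "norm v \<ge> 1" "p > 0"
  shows "norm v powr (- p) - jap v powr (- p) \<le> p / 2 * 2 powr (p + 2) * jap v powr (- p - 2)"
proof -
  define r where "r = norm v"
  have r: "r \<ge> 1" using assms by (simp add: r_def)
  have j: "jap v = r * (1 + r powr (- 2)) powr (1/2)"
  proof -
    have "1 + r\<^sup>2 = r\<^sup>2 * (1 + r powr (- 2))"
      using r by (simp add: powr_minus powr_numeral field_simps)
    then show ?thesis
      using r unfolding jap_def r_def[symmetric] by (simp add: powr_half_sqrt real_sqrt_mult)
  qed
  have "jap v powr (- p) = r powr (- p) * (1 + r powr (- 2)) powr (- (p / 2))"
    unfolding j using r by (simp add: powr_mult powr_powr)
  also have "\<dots> \<ge> r powr (- p) * (1 - p / 2 * r powr (- 2))"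
    using assms by (intro mult_left_mono one_minus_le_powr_minus) auto
  finally have "r powr (- p) - jap v powr (- p) \<le> p / 2 * r powr (- p - 2)"
    by (simp add: algebra_simps powr_add[symmetric])
  also have "r powr (- p - 2) \<le> (jap v / 2) powr (- p - 2)"
    using jap_le[of v r] r assms jap_pos[of v] by (intro powr_mono2') (auto simp: r_def)
  also have "(jap v / 2) powr (- p - 2) = 2 powr (p + 2) * jap v powr (- p - 2)"
    using jap_pos[of v] powr_minus[of 2 "p + 2"] by (simp add: powr_divide field_simps)
  finally show ?thesis using assms by (simp add: r_def mult_left_mono)
qed

text \<open>The exactly computable model for the mass of \<open>jap powr (- d)\<close> on a ball:
  the radial weight \<open>r ^ (d - 1)\<close> turns the integrand into
  \<open>1 / r\<close>.\<close>

lemma has_bochner_integral_norm_powr_annulus: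
  assumes "R \<ge> 1"
  shows "has_bochner_integral lborel
    (\<lambda>v::real^'n::finite. norm v powr (- real CARD('n)) * indicator {1..R} (norm v)) (sphere_area TYPE('n) * ln R)"
proof (rule has_bochner_integral_nn_integral)
  let ?d = "real CARD('n)"
  have "(\<integral>\<^sup>+(v::real^'n). ennreal (norm v powr (- ?d) * indicator {1..R} (norm v)) \<partial>lborel)
    = ennreal (sphere_area TYPE('n)) *
      (\<integral>\<^sup>+r. ennreal (r powr (- ?d) * indicator {1..R} r) * ennreal (r ^ (CARD('n) - 1)) * indicator {0..} r \<partial>lborel)"
    by (rule nn_integral_radial_sphere_area) measurable
  also have "(\<integral>\<^sup>+r. ennreal (r powr (- ?d) * indicator {1..R} r) * ennreal (r ^ (CARD('n) - 1)) * indicator {0..} r \<partial>lborel)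
    = (\<integral>\<^sup>+r. ennreal (1 / r) * indicator {1..R} r \<partial>lborel)"
  proof (intro nn_integral_cong)
    fix r :: real
    have "r powr (- ?d) * r ^ (CARD('n) - 1) = 1 / r" if "r \<ge> 1"
    proof -
      have "r ^ (CARD('n) - 1) = r powr (?d - 1)"
        using that by (subst powr_realpow[symmetric]) (auto simp: of_nat_diff Suc_leI)
      then show ?thesis using that by (simp only: powr_add[symmetric]) (simp add: powr_minus_divide)
    qed
    then show "ennreal (r powr (- ?d) * indicator {1..R} r) * ennreal (r ^ (CARD('n) - 1)) * indicator {0..} r
      = ennreal (1 / r) * indicator {1..R} r"
      by (auto simp: ennreal_mult'[symmetric] split: split_indicator)
  qed
  also have "\<dots> = ennreal (ln R - ln 1)"
    using assms by (intro nn_integral_FTC_Icc) (auto intro!: derivative_eq_intros simp: field_simps)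
  finally show "(\<integral>\<^sup>+(v::real^'n). ennreal (norm v powr (- ?d) * indicator {1..R} (norm v)) \<partial>lborel)
    = ennreal (sphere_area TYPE('n) * ln R)"
    using assms sphere_area_pos[where 'n='n] by (simp add: ennreal_mult'[symmetric])
qed (use assms sphere_area_pos[where 'n='n] in auto)

text \<open>The integral differs from the model integral of \<open>norm v powr (- d)\<close> over
  the annulus from 1 to \<open>R\<close> by at most the integral of one function that does not
  depend on \<open>R\<close>.\<close>

lemma integral_jap_ball_log:
  "\<exists>K. \<forall>R\<ge>1. \<bar>(\<integral>(v::real^'n::finite). jap v powr (- real CARD('n)) * indicator (ball 0 R) v \<partial>lborel)
      - sphere_area TYPE('n) * ln R\<bar> \<le> K"
proof -
  let ?d = "real CARD('n)"
  \<comment> \<open>This dominates the difference of the two integrands for every \<open>R\<close>: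
    the indicator covers the unit ball, where the model vanishes, and the second term is the bound
    for \<open>norm v powr (- d) - jap v powr (- d)\<close>.\<close>
  define h where "h = (\<lambda>v::real^'n. indicator (ball 0 1) v + ?d / 2 * 2 powr (?d + 2) * jap v powr (- ?d - 2))"
  have d: "?d > 0" by simp
  have h: "integrable lborel h" unfolding h_def
    using emeasure_lborel_ball_finite[of "0::real^'n" 1]
    by (intro Bochner_Integration.integrable_add integrable_mult_right integrable_jap_powr integrable_real_indicator)
       auto
  have "\<bar>(\<integral>(v::real^'n). jap v powr (- ?d) * indicator (ball 0 R) v \<partial>lborel)
      - sphere_area TYPE('n) * ln R\<bar> \<le> integral\<^sup>L lborel h" if R: "R \<ge> 1" for R
  proof -
    let ?g = "\<lambda>v::real^'n. norm v powr (- ?d) * indicator {1..R} (norm v)"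
    let ?f = "\<lambda>v::real^'n. jap v powr (- ?d) * indicator (ball 0 R) v"
    have g: "integrable lborel ?g" "integral\<^sup>L lborel ?g = sphere_area TYPE('n) * ln R"
      using has_bochner_integral_norm_powr_annulus[OF R, where 'n='n]
      by (auto simp: has_bochner_integral_iff)
    have f: "integrable lborel ?f" by (rule integrable_jap_ball)
    have "\<bar>integral\<^sup>L lborel ?f - integral\<^sup>L lborel ?g\<bar> = \<bar>\<integral>v. ?f v - ?g v \<partial>lborel\<bar>"
      using f g by simp
    also have "\<dots> \<le> (\<integral>v. \<bar>?f v - ?g v\<bar> \<partial>lborel)" by (rule integral_abs_bound)
    also have "\<dots> \<le> integral\<^sup>L lborel h"
    proof (rule integral_mono_AE)
      \<comment> \<open>The ball is open and the annulus closed, so the two domains differ on the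
        sphere of radius \<open>R\<close>, where the comparison would fail.\<close>
      have "(sphere 0 R :: (real^'n) set) \<in> null_sets lborel"
        using negligible_sphere[of "0::real^'n" R]
        by (auto simp: null_sets_completion_iff negligible_iff_null_sets)
      then have "AE v in lborel. v \<notin> (sphere 0 R :: (real^'n) set)" by (rule AE_not_in)
      then show "AE v in lborel. \<bar>?f v - ?g v\<bar> \<le> h v"
      proof eventually_elim
        case (elim v)
        show ?case
        proof (cases "norm v \<ge> 1")
          case True
          have "jap v powr (- ?d) \<le> norm v powr (- ?d)"
            using True norm_le_jap[of v] by (intro powr_mono2') auto
          then show ?thesis
            using True elim norm_powr_diff_jap_powr_le[OF True d]
            by (auto simp: h_def split: split_indicator)
        next
          case False
          have "jap v powr (- ?d) \<le> 1 powr (- ?d)" using one_le_jap[of v] by (intro powr_mono2') auto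
          then have "\<bar>?f v - ?g v\<bar> \<le> 1" using False R by (auto split: split_indicator)
          moreover have "0 \<le> ?d / 2 * 2 powr (?d + 2) * jap v powr (- ?d - 2)" by simp
          moreover have "h v = 1 + ?d / 2 * 2 powr (?d + 2) * jap v powr (- ?d - 2)"
            using False by (simp add: h_def)
          ultimately show ?thesis by linarith
        qed
      qed
    qed (use f g h in auto)
    finally show ?thesis using g by simp
  qed
  then show ?thesis by blast
qed

section \<open>Equilibria\<close>

lemma Cauchy_Schwarz_integral:
  fixes f g :: "'a \<Rightarrow> real"
  assumes [measurable]: "f \<in> borel_measurable M" "g \<in> borel_measurable M"
    and f: "integrable M (\<lambda>x. (f x)\<^sup>2)" and g: "integrable M (\<lambda>x. (g x)\<^sup>2)"
  shows "integrable M (\<lambda>x. f x * g x)"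
    and "(\<integral>x. \<bar>f x * g x\<bar> \<partial>M) \<le> sqrt (\<integral>x. (f x)\<^sup>2 \<partial>M) * sqrt (\<integral>x. (g x)\<^sup>2 \<partial>M)"
proof -
  show fg: "integrable M (\<lambda>x. f x * g x)"
  proof (rule Bochner_Integration.integrable_bound)
    show "integrable M (\<lambda>x. (f x)\<^sup>2 + (g x)\<^sup>2)" using f g by simp
    have "\<bar>a * b\<bar> \<le> a\<^sup>2 + b\<^sup>2" for a b :: real
      using sum_squares_bound[of "\<bar>a\<bar>" "\<bar>b\<bar>"] mult_nonneg_nonneg[OF abs_ge_zero[of a] abs_ge_zero[of b]]
      unfolding abs_mult power2_abs by linarith
    then show "AE x in M. norm (f x * g x) \<le> norm ((f x)\<^sup>2 + (g x)\<^sup>2)" by simp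
  qed measurable
  have "(\<integral>\<^sup>+x. ennreal \<bar>f x\<bar> * ennreal \<bar>g x\<bar> \<partial>M)\<^sup>2 \<le>
    (\<integral>\<^sup>+x. (ennreal \<bar>f x\<bar>)\<^sup>2 \<partial>M) * (\<integral>\<^sup>+x. (ennreal \<bar>g x\<bar>)\<^sup>2 \<partial>M)"
    by (rule Cauchy_Schwarz_nn_integral) measurable
  also have "(\<lambda>x. ennreal \<bar>f x\<bar> * ennreal \<bar>g x\<bar>) = (\<lambda>x. ennreal \<bar>f x * g x\<bar>)"
    by (simp add: abs_mult ennreal_mult)
  finally have "ennreal ((\<integral>x. \<bar>f x * g x\<bar> \<partial>M)\<^sup>2) \<le> ennreal ((\<integral>x. (f x)\<^sup>2 \<partial>M) * (\<integral>x. (g x)\<^sup>2 \<partial>M))"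
    using f g fg by (simp add: nn_integral_eq_integral ennreal_power ennreal_mult)
  then have "(\<integral>x. \<bar>f x * g x\<bar> \<partial>M)\<^sup>2 \<le> (\<integral>x. (f x)\<^sup>2 \<partial>M) * (\<integral>x. (g x)\<^sup>2 \<partial>M)"
    by (subst (asm) ennreal_le_iff) auto
  then show "(\<integral>x. \<bar>f x * g x\<bar> \<partial>M) \<le> sqrt (\<integral>x. (f x)\<^sup>2 \<partial>M) * sqrt (\<integral>x. (g x)\<^sup>2 \<partial>M)"
    by (simp add: real_le_rsqrt real_sqrt_mult[symmetric])
qed

section \<open>Positivity, moments and mass of the equilibrium\<close>

lemma eq_const_nonneg: "eq_const TYPE('n::finite) a \<beta> \<ge> 0"
  unfolding eq_const_def by simp

lemma equilibrium_finite:
  assumes "equilibrium C (ereal a) \<beta> M"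
  shows "M = (\<lambda>v::real^'n::finite. eq_const TYPE('n) a \<beta> * jap v powr (- (real CARD('n) + a)))"
  using assms unfolding equilibrium_def by (simp add: fun_eq_iff)

lemma equilibrium_infinite:
  assumes "equilibrium C \<infinity> \<beta> M"
  shows "smooth M" "M v > 0" "M v \<le> decay_const C k * jap v powr (- real k)"
  using assms unfolding equilibrium_def if_P[OF refl] by blast+

lemma equilibrium_normalised:
  assumes "equilibrium C \<alpha> \<beta> M"
  shows "integrable lborel (\<lambda>v. jap v powr (-\<beta>) * M v)" "(\<integral>v. jap v powr (-\<beta>) * M v \<partial>lborel) = 1"
  using assms unfolding equilibrium_def by blast+

lemma equilibrium_nonneg:
  assumes "equilibrium C \<alpha> \<beta> M" "\<alpha> \<ge> 0"
  shows "M v \<ge> 0"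
proof (cases \<alpha>)
  case (real a)
  then show ?thesis using equilibrium_finite[of C a \<beta> M] assms by (simp add: eq_const_nonneg)
next
  case PInf
  then show ?thesis using equilibrium_infinite(2)[of C \<beta> M v] assms by simp
qed (use assms in auto)

text \<open>The quotient is 0 only if its denominator is 0, which includes the case of a divergent
  integral. Then \<open>M\<close> would vanish identically, against the normalisation of its
  weighted mass.\<close>

lemma eq_const_pos:
  assumes "equilibrium C (ereal a) \<beta> (M :: real^'n::finite \<Rightarrow> real)"
  shows "eq_const TYPE('n) a \<beta> > 0"
proof -
  have "eq_const TYPE('n) a \<beta> \<noteq> 0"
    using equilibrium_normalised(2)[OF assms] equilibrium_finite[OF assms] by auto
  then show ?thesis using eq_const_nonneg[of a \<beta>, where 'n='n] by simp
qed

lemma equilibrium_measurable: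
  assumes "equilibrium C \<alpha> \<beta> M" "\<alpha> \<ge> 0"
  shows "M \<in> borel_measurable borel"
proof (cases \<alpha>)
  case (real a)
  then have "equilibrium C (ereal a) \<beta> M" using assms by simp
  from equilibrium_finite[OF this] show ?thesis by simp
next
  case PInf
  then have "smooth M" using equilibrium_infinite(1)[of C \<beta> M] assms by simp
  then have "Ck 0 M" unfolding smooth_def by blast
  then show ?thesis by (simp add: borel_measurable_continuous_onI)
qed (use assms in auto)

text \<open>The bound \<open>B\<close> must not depend on \<open>M\<close>. For finite
  \<open>\<alpha>\<close> the equilibrium is determined by \<open>\<alpha>\<close> and
  \<open>\<beta>\<close>, so its moment is a single number; for
  \<open>\<alpha> = \<infinity>\<close> the decay constants provide a common integrable
  majorant.\<close>

lemma equilibrium_moment_bound: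
  assumes \<alpha>: "\<alpha> \<ge> 0" and p: "ereal p < \<alpha>"
  shows "\<exists>B. \<forall>M. equilibrium C \<alpha> \<beta> M \<longrightarrow>
    integrable lborel (\<lambda>v::real^'n::finite. jap v powr p * M v) \<and> (\<integral>v. jap v powr p * M v \<partial>lborel) \<le> B"
proof (cases \<alpha>)
  case (real a)
  have "(\<lambda>v::real^'n. jap v powr p * M v) =
      (\<lambda>v. eq_const TYPE('n) a \<beta> * jap v powr (p - (real CARD('n) + a)))" if M: "equilibrium C \<alpha> \<beta> M" for M
  proof -
    have e: "p - (real CARD('n) + a) = p + - (real CARD('n) + a)" by simp
    have "M = (\<lambda>v. eq_const TYPE('n) a \<beta> * jap v powr (- (real CARD('n) + a)))"
      using M real by (intro equilibrium_finite[of C a \<beta> M]) simp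
    then show ?thesis unfolding e powr_add by (simp only: mult_ac)
  qed
  moreover have "integrable lborel (\<lambda>v::real^'n. eq_const TYPE('n) a \<beta> * jap v powr (p - (real CARD('n) + a)))"
    using \<alpha> p real by (intro integrable_mult_right integrable_jap_powr) auto
  ultimately show ?thesis by auto
next
  case PInf
  obtain k :: nat where k: "real k > p + real CARD('n)" using reals_Archimedean2 by blast
  let ?g = "\<lambda>v::real^'n. decay_const C k * jap v powr (p - real k)"
  have g: "integrable lborel ?g"
    using k by (intro integrable_mult_right integrable_jap_powr) auto
  show ?thesis
  proof (intro exI allI impI)
    fix M assume M: "equilibrium C \<alpha> \<beta> M"
    note [measurable] = equilibrium_measurable[OF M \<alpha>]
    have le: "jap v powr p * M v \<le> ?g v" for v
    proof -
      have "jap v powr p * M v \<le> jap v powr p * (decay_const C k * jap v powr (- real k))"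
        using equilibrium_infinite(3)[of C \<beta> M v k] M PInf by (intro mult_left_mono) auto
      then show ?thesis by (simp add: powr_diff powr_minus divide_inverse mult_ac)
    qed
    have "integrable lborel (\<lambda>v. jap v powr p * M v)"
      using equilibrium_nonneg[OF M \<alpha>] le
      by (intro Bochner_Integration.integrable_bound[OF g]) (auto intro!: AE_I2 order.trans[OF _ abs_ge_self])
    from this integral_mono[OF this g le]
    show "integrable lborel (\<lambda>v. jap v powr p * M v) \<and> (\<integral>v. jap v powr p * M v \<partial>lborel) \<le> integral\<^sup>L lborel ?g"
      by (rule conjI)
  qed
qed (use \<alpha> p in auto)

lemma equilibrium_integrable:
  assumes "equilibrium C \<alpha> \<beta> M" "\<alpha> > 0"
  shows "integrable lborel (M :: real ^ 'n::finite \<Rightarrow> real)"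
proof -
  have "\<alpha> \<ge> 0" "ereal 0 < \<alpha>" using assms(2) by (simp_all flip: zero_ereal_def)
  from equilibrium_moment_bound[OF this, of C \<beta>] assms(1)
  have "integrable lborel (\<lambda>v. jap v powr 0 * M v)" by blast
  moreover have "jap v powr 0 = 1" for v :: "real^'n" using jap_pos[of v] by simp
  ultimately show ?thesis by (simp only: mult_1)
qed

lemma jap_powr_half_power2: "(jap v powr (p / 2))\<^sup>2 = jap v powr p"
  by (simp add: power2_eq_square powr_add[symmetric])

text \<open>The mass ends up in a denominator, so it has to be bounded below uniformly in
  \<open>M\<close>. For finite \<open>\<alpha>\<close> it is one fixed positive number. For
  \<open>\<alpha> = \<infinity>\<close>, Cauchy-Schwarz bounds the normalised integral of
  \<open>jap powr (-\<beta>) * M\<close> by the square root of the mass times that of the moment of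
  order \<open>- 2 * \<beta>\<close>, which is bounded uniformly.\<close>

lemma equilibrium_mass_lower_bound:
  assumes "\<alpha> + ereal \<beta> > 0" "\<alpha> > 0"
  shows "\<exists>m>0. \<forall>M. equilibrium C \<alpha> \<beta> M \<longrightarrow> m \<le> (\<integral>(v::real^'n::finite). M v \<partial>lborel)"
proof -
  have \<alpha>: "\<alpha> \<ge> 0" using assms by simp
  show ?thesis
  proof (cases \<alpha>)
    case (real a)
    let ?f = "\<lambda>v::real^'n. eq_const TYPE('n) a \<beta> * jap v powr (- (real CARD('n) + a))"
    have "integrable lborel ?f"
      using assms real by (intro integrable_mult_right integrable_jap_powr) auto
    have "integral\<^sup>L lborel ?f > 0" if "equilibrium C \<alpha> \<beta> M" for M
    proof -
      have pos: "?f v > 0" for v using that real eq_const_pos[of C a \<beta> M] jap_pos[of v] by simp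
      have "integral\<^sup>L lborel ?f \<noteq> 0"
      proof
        assume "integral\<^sup>L lborel ?f = 0"
        then have "AE v in lborel. ?f v = 0"
          using integral_nonneg_eq_0_iff_AE[OF \<open>integrable lborel ?f\<close>] pos by (simp add: less_imp_le)
        then have "AE v in (lborel :: (real^'n) measure). False"
          by eventually_elim (use pos less_irrefl in metis)
        then show False by (simp add: eventually_False ae_filter_eq_bot_iff)
      qed
      moreover have "integral\<^sup>L lborel ?f \<ge> 0" using pos by (intro Bochner_Integration.integral_nonneg) (simp add: less_imp_le)
      ultimately show ?thesis by linarith
    qed
    \<comment> \<open>Positivity of the integral is known only in the presence of an equilibrium; if
      there is none, any positive \<open>m\<close> will do.\<close>
    then show ?thesis
      using equilibrium_finite[of C a \<beta>] real by (cases "\<exists>M. equilibrium C \<alpha> \<beta> M") (auto intro: exI[of _ 1] simp del: integral_mult_right_zero)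
  next
    case PInf
    obtain B where B: "\<And>M. equilibrium C \<alpha> \<beta> M \<Longrightarrow>
        integrable lborel (\<lambda>v::real^'n. jap v powr (- 2 * \<beta>) * M v) \<and> (\<integral>v. jap v powr (- 2 * \<beta>) * M v \<partial>lborel) \<le> B"
      using equilibrium_moment_bound[of \<alpha> "- 2 * \<beta>" C \<beta>] PInf by auto
    \<comment> \<open>Taking \<open>max B 1\<close> instead of \<open>B\<close> makes the
      denominator positive whatever \<open>B\<close> is.\<close>
    have "1 / max B 1 \<le> (\<integral>v. M v \<partial>lborel)" if M: "equilibrium C \<alpha> \<beta> M" for M :: "real^'n \<Rightarrow> real"
    proof -
      note [measurable] = equilibrium_measurable[OF M \<alpha>]
      have nn: "M v \<ge> 0" for v by (rule equilibrium_nonneg[OF M \<alpha>])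
      have e1: "(jap v powr (- \<beta>) * sqrt (M v))\<^sup>2 = jap v powr (- 2 * \<beta>) * M v" for v
        using nn jap_powr_half_power2[of v "- 2 * \<beta>"] by (simp add: power_mult_distrib)
      have e2: "\<bar>sqrt (M v) * (jap v powr (- \<beta>) * sqrt (M v))\<bar> = jap v powr (- \<beta>) * M v" for v
        using nn[of v] by (simp add: mult_ac abs_mult)
      have "1 = (\<integral>v. \<bar>sqrt (M v) * (jap v powr (- \<beta>) * sqrt (M v))\<bar> \<partial>lborel)"
        using equilibrium_normalised(2)[OF M] by (simp only: e2)
      also have "\<dots> \<le> sqrt (\<integral>v. (sqrt (M v))\<^sup>2 \<partial>lborel) * sqrt (\<integral>v. (jap v powr (- \<beta>) * sqrt (M v))\<^sup>2 \<partial>lborel)"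
        using B[OF M] equilibrium_integrable[OF M assms(2)] nn by (intro Cauchy_Schwarz_integral(2); (simp only: e1)?) auto
      also have "\<dots> \<le> sqrt (\<integral>v. M v \<partial>lborel) * sqrt (max B 1)"
        using B[OF M] nn by (simp only: e1) (auto intro!: mult_mono)
      finally have "1 \<le> (\<integral>v. M v \<partial>lborel) * max B 1"
        by (simp add: real_sqrt_mult[symmetric])
      then show ?thesis by (simp add: field_simps)
    qed
    then show ?thesis by (intro exI[of _ "1 / max B 1"]) auto
  qed (use assms in auto)
qed

section \<open>The deviation of a function from 1, tested against the equilibrium\<close>

text \<open>Cauchy-Schwarz after writing \<open>M\<close> as the product of
  \<open>jap powr (-\<beta>/2) * sqrt M\<close> and \<open>jap powr (\<beta>/2) * sqrt M\<close>.
  This converts the smallness of the mode's deviation from 1 in the weight \<open>-\<beta>\<close>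
  into smallness of its mass on any set of finite \<open>\<beta>\<close>-moment.\<close>

lemma L2w_diff_one_bound:
  fixes M :: "real^'n::finite \<Rightarrow> real"
  assumes M: "M \<in> borel_measurable borel" "\<And>v. M v \<ge> 0" "integrable lborel (\<lambda>v. jap v powr (- \<beta>) * M v)"
    and f: "f \<in> L2w M (- \<beta>)"
    and S: "S \<in> sets borel" and w: "integrable lborel (\<lambda>v. jap v powr \<beta> * M v * indicator S v)"
  shows "integrable lborel (\<lambda>v. cmod (f v - 1) * M v * indicator S v)"
    and "(\<integral>v. cmod (f v - 1) * M v * indicator S v \<partial>lborel) \<le>
      normw M (- \<beta>) (\<lambda>v. f v - 1) * sqrt (\<integral>v. jap v powr \<beta> * M v * indicator S v \<partial>lborel)"
proof -
  note [measurable] = M(1) S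
  have [measurable]: "f \<in> borel_measurable borel" using f by (simp add: L2w_def)
  have fi: "integrable lborel (\<lambda>v. (cmod (f v - 1))\<^sup>2 * jap v powr (- \<beta>) * M v)"
  proof (rule Bochner_Integration.integrable_bound)
    show "integrable lborel (\<lambda>v. 2 * ((cmod (f v))\<^sup>2 * jap v powr (- \<beta>) * M v) + 2 * (jap v powr (- \<beta>) * M v))"
      using f M(3) by (simp add: L2w_def)
    have "(cmod (z - 1))\<^sup>2 \<le> 2 * (cmod z)\<^sup>2 + 2" for z
    proof -
      have "(cmod (z - 1))\<^sup>2 \<le> (cmod z + 1)\<^sup>2"
        using norm_triangle_ineq4[of z 1] by (intro power_mono) auto
      also have "\<dots> \<le> 2 * (cmod z)\<^sup>2 + 2" using sum_squares_bound[of "cmod z" 1] by (simp add: power2_sum)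
      finally show ?thesis .
    qed
    then have le: "(cmod (f v - 1))\<^sup>2 * (jap v powr (- \<beta>) * M v) \<le> (2 * (cmod (f v))\<^sup>2 + 2) * (jap v powr (- \<beta>) * M v)" for v
      using M(2) by (intro mult_right_mono) auto
    show "AE v in lborel. norm ((cmod (f v - 1))\<^sup>2 * jap v powr (- \<beta>) * M v)
        \<le> norm (2 * ((cmod (f v))\<^sup>2 * jap v powr (- \<beta>) * M v) + 2 * (jap v powr (- \<beta>) * M v))"
    proof (intro AE_I2)
      fix v
      have "norm ((cmod (f v - 1))\<^sup>2 * jap v powr (- \<beta>) * M v) = (cmod (f v - 1))\<^sup>2 * (jap v powr (- \<beta>) * M v)"
        using M(2)[of v] by simp
      also have "\<dots> \<le> 2 * ((cmod (f v))\<^sup>2 * jap v powr (- \<beta>) * M v) + 2 * (jap v powr (- \<beta>) * M v)"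
        using le[of v] by (simp only: distrib_right mult.assoc)
      finally show "norm ((cmod (f v - 1))\<^sup>2 * jap v powr (- \<beta>) * M v)
        \<le> norm (2 * ((cmod (f v))\<^sup>2 * jap v powr (- \<beta>) * M v) + 2 * (jap v powr (- \<beta>) * M v))"
        unfolding real_norm_def by linarith
    qed
  qed measurable
  define F where "F v = cmod (f v - 1) * jap v powr (- \<beta> / 2) * sqrt (M v)" for v
  define G where "G v = jap v powr (\<beta> / 2) * sqrt (M v) * indicator S v" for v
  have [measurable]: "F \<in> borel_measurable borel" "G \<in> borel_measurable borel"
    unfolding F_def G_def by measurable
  have F2: "(F v)\<^sup>2 = (cmod (f v - 1))\<^sup>2 * jap v powr (- \<beta>) * M v" for v
    using M(2)[of v] by (simp only: F_def power_mult_distrib jap_powr_half_power2 real_sqrt_pow2)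
  have G2: "(G v)\<^sup>2 = jap v powr \<beta> * M v * indicator S v" for v
    using M(2)[of v]
    by (simp only: G_def power_mult_distrib jap_powr_half_power2 real_sqrt_pow2) (simp split: split_indicator)
  have FG: "F v * G v = cmod (f v - 1) * M v * indicator S v" for v
  proof -
    have "jap v powr (- \<beta> / 2) * jap v powr (\<beta> / 2) = 1"
      using jap_pos[of v] by (simp add: powr_add[symmetric])
    moreover have "sqrt (M v) * sqrt (M v) = M v" using M(2) by simp
    ultimately have "cmod (f v - 1) * M v * indicator S v = cmod (f v - 1) *
      (jap v powr (- \<beta> / 2) * jap v powr (\<beta> / 2)) * (sqrt (M v) * sqrt (M v)) * indicator S v" by simp
    then show ?thesis unfolding F_def G_def by (simp only: mult_ac)
  qed
  have FG': "\<bar>F v * G v\<bar> = cmod (f v - 1) * M v * indicator S v" for v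
    unfolding FG using M(2)[of v] by simp
  have "integrable lborel (\<lambda>v. (F v)\<^sup>2)" "integrable lborel (\<lambda>v. (G v)\<^sup>2)" using fi w by (simp_all only: F2 G2)
  note CS = Cauchy_Schwarz_integral[OF _ _ this]
  show "integrable lborel (\<lambda>v. cmod (f v - 1) * M v * indicator S v)" using CS(1) by (simp add: FG)
  show "(\<integral>v. cmod (f v - 1) * M v * indicator S v \<partial>lborel) \<le>
      normw M (- \<beta>) (\<lambda>v. f v - 1) * sqrt (\<integral>v. jap v powr \<beta> * M v * indicator S v \<partial>lborel)"
    using CS(2) by (simp add: FG' F2 G2 normw_def)
qed

section \<open>The fluid mode\<close>

text \<open>All limits below are uniform limits over this set, so that a rate found for it depends
  only on the constants. The components are the objects that occur in the quotient and in its limit;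
  the operator and the limit profiles are existentially quantified.\<close>

definition admissible ::
  "'n::finite hyp_consts \<Rightarrow> ereal \<Rightarrow> real \<Rightarrow> real \<Rightarrow>
   ((real ^ 'n \<Rightarrow> real) \<times> (real \<Rightarrow> real ^ 'n \<Rightarrow> real ^ 'n \<Rightarrow> complex) \<times> (real \<Rightarrow> real) \<times> real) set" where
  "admissible C \<alpha> \<beta> lam = {(M, \<phi>, \<mu>, \<mu>0). equilibrium C \<alpha> \<beta> M \<and>
     (\<exists>L Dt. fluid_mode C \<alpha> \<beta> lam M L Dt \<phi> \<mu> \<mu>0) \<and> (\<exists>\<Phi> \<Omega>. mode_scaling C \<alpha> \<beta> M \<phi> \<mu> \<Phi> \<Omega>)}"

text \<open>A bound for the weighted norm of \<open>\<phi> - 1\<close> through the constants alone,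
  \<open>\<mu>\<close> being replaced by its upper bound. The absolute value is there because no
  sign is prescribed for \<open>mode_const C\<close>.\<close>

definition mode_error :: "'n::finite hyp_consts \<Rightarrow> ereal \<Rightarrow> real \<Rightarrow> real \<Rightarrow> real" where
  "mode_error C \<alpha> \<beta> \<eta> = \<bar>mode_const C\<bar> * sqrt (theta_upper C * Theta \<alpha> \<beta> \<eta>)"

section \<open>Smallness of the error terms and consequences of the hypotheses\<close>

text \<open>This is \<open>0 < \<alpha> + \<beta> \<le> 2 + 2 * \<beta>\<close>.\<close>

lemma one_plus_beta_pos:
  assumes "\<alpha> + ereal \<beta> > 0" "\<alpha> \<le> ereal (2 + \<beta>)"
  shows "1 + \<beta> > 0"
  using assms by (cases \<alpha>) auto

lemma tendsto_Theta:
  assumes "\<alpha> + ereal \<beta> > 0" "\<alpha> \<ge> 0"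
  shows "(Theta \<alpha> \<beta> \<longlongrightarrow> 0) (at_right 0)"
proof (cases "\<alpha> \<ge> ereal (2 + \<beta>)")
  case True
  have "((\<lambda>\<eta>::real. \<eta>\<^sup>2) \<longlongrightarrow> 0) (at_right 0)" by real_asymp
  moreover have "((\<lambda>\<eta>::real. \<eta>\<^sup>2 * \<bar>ln \<eta>\<bar>) \<longlongrightarrow> 0) (at_right 0)" by real_asymp
  ultimately show ?thesis
    using True unfolding Theta_def[abs_def] by (cases "\<alpha> = ereal (2 + \<beta>)") (simp_all add: order.strict_iff_order)
next
  case False
  then obtain a where a: "\<alpha> = ereal a" using assms by (cases \<alpha>) auto
  have "1 + \<beta> > 0" by (rule one_plus_beta_pos[OF assms(1)]) (use False in auto)
  then have "(a + \<beta>) / (1 + \<beta>) > 0" using assms a by simp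
  moreover have "((\<lambda>\<eta>::real. \<eta> powr p) \<longlongrightarrow> 0) (at_right 0)" if "p > 0" for p
    using that by real_asymp
  ultimately show ?thesis using False a unfolding Theta_def[abs_def] by auto
qed

lemma tendsto_mode_error:
  assumes "\<alpha> + ereal \<beta> > 0" "\<alpha> \<ge> 0"
  shows "(mode_error C \<alpha> \<beta> \<longlongrightarrow> 0) (at_right 0)"
  unfolding mode_error_def[abs_def]
  using tendsto_mult[OF tendsto_const
      tendsto_real_sqrt[OF tendsto_mult[OF tendsto_const tendsto_Theta[OF assms]]]] by simp

lemma fluid_mode_bounds:
  assumes "fluid_mode C \<alpha> \<beta> lam M L Dt \<phi> \<mu> \<mu>0" "\<eta> \<in> {0<..<eta0 C}" "\<sigma> \<in> sphere 0 1"
  shows "\<phi> \<eta> \<sigma> \<in> L2w M (- \<beta>)" "\<mu> \<eta> > 0" "\<mu> \<eta> < theta_upper C * Theta \<alpha> \<beta> \<eta>"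
    and "normw M (- \<beta>) (\<lambda>v. \<phi> \<eta> \<sigma> v - 1) \<le> mode_error C \<alpha> \<beta> \<eta>"
proof -
  have *: "is_fluid_pair \<beta> M L Dt (small_r0 C) \<eta> \<sigma> (\<phi> \<eta> \<sigma>) (of_real (\<mu> \<eta>))"
    "normw M (- \<beta>) (\<lambda>v. \<phi> \<eta> \<sigma> v - 1) \<le> mode_const C * sqrt (\<mu> \<eta>)"
    "\<mu> \<eta> > 0" "\<mu> \<eta> < theta_upper C * Theta \<alpha> \<beta> \<eta>"
    using assms unfolding fluid_mode_def by blast+
  then show "\<phi> \<eta> \<sigma> \<in> L2w M (- \<beta>)" "\<mu> \<eta> > 0" "\<mu> \<eta> < theta_upper C * Theta \<alpha> \<beta> \<eta>"
    unfolding is_fluid_pair_def by blast+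
  have "mode_const C * sqrt (\<mu> \<eta>) \<le> \<bar>mode_const C\<bar> * sqrt (theta_upper C * Theta \<alpha> \<beta> \<eta>)"
    using * by (intro mult_mono) auto
  then show "normw M (- \<beta>) (\<lambda>v. \<phi> \<eta> \<sigma> v - 1) \<le> mode_error C \<alpha> \<beta> \<eta>"
    using * unfolding mode_error_def by linarith
qed

lemma admissible_D:
  assumes "(M, \<phi>, \<mu>, \<mu>0) \<in> admissible C \<alpha> \<beta> lam"
  obtains L Dt \<Phi> \<Omega> where "equilibrium C \<alpha> \<beta> M" "fluid_mode C \<alpha> \<beta> lam M L Dt \<phi> \<mu> \<mu>0"
    "mode_scaling C \<alpha> \<beta> M \<phi> \<mu> \<Phi> \<Omega>"
  using assms unfolding admissible_def by blast

lemma fluid_mode_eta0_pos: "fluid_mode C \<alpha> \<beta> lam M L Dt \<phi> \<mu> \<mu>0 \<Longrightarrow> eta0 C > 0"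
  unfolding fluid_mode_def by blast

lemma mode_scaling_growth:
  assumes "mode_scaling C \<alpha> \<beta> M \<phi> \<mu> \<Phi> \<Omega>" "\<alpha> \<le> ereal (2 + \<beta>)"
  shows "0 < eta1 C" "growth_exp C > 0"
    and "\<sigma> \<in> sphere 0 1 \<Longrightarrow> \<eta> \<in> {0<..<eta1 C} \<Longrightarrow> AE u in lborel.
      cmod (rescaled \<beta> \<phi> \<eta> \<sigma> u) \<le> growth_const C * eta_abs \<beta> \<eta> u powr (growth_exp C * \<mu> \<eta>)"
proof -
  note * = assms(1)[unfolded mode_scaling_def Let_def, THEN conjunct2, THEN mp, OF assms(2)]
  show "0 < eta1 C" "growth_exp C > 0"
    using *[THEN conjunct1] *[THEN conjunct2, THEN conjunct2, THEN conjunct1] .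
  show "AE u in lborel. cmod (rescaled \<beta> \<phi> \<eta> \<sigma> u) \<le> growth_const C * eta_abs \<beta> \<eta> u powr (growth_exp C * \<mu> \<eta>)"
    if "\<sigma> \<in> sphere 0 1" "\<eta> \<in> {0<..<eta1 C}"
  proof -
    have "AE u in lborel.
         cmod (rescaled \<beta> \<phi> \<eta> \<sigma> u) \<le> growth_const C * eta_abs \<beta> \<eta> u powr (growth_exp C * \<mu> \<eta>) \<and>
         \<bar>Im (rescaled \<beta> \<phi> \<eta> \<sigma> u)\<bar> \<le> im_const C * eta_abs \<beta> \<eta> u powr (\<beta> + min (real_of_ereal \<alpha>) 1 - delta C)"
      using *[THEN conjunct2, THEN conjunct2, THEN conjunct2, THEN conjunct2, THEN conjunct2, THEN conjunct1,
          THEN bspec, OF that(1), THEN conjunct2, THEN conjunct2, THEN bspec, OF that(2)] .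
    then show ?thesis by eventually_elim blast
  qed
qed

lemma mode_scaling_tail:
  assumes "mode_scaling C \<alpha> \<beta> M \<phi> \<mu> \<Phi> \<Omega>" "\<alpha> \<le> ereal (2 + \<beta>)" "\<alpha> \<le> ereal \<beta>"
    "\<sigma> \<in> sphere 0 1" "\<eta> \<in> {0<..<eta1 C}"
  shows "(\<integral>\<^sup>+u\<in>{u. norm u \<ge> 1}. ennreal ((cmod (rescaled \<beta> \<phi> \<eta> \<sigma> u))\<^sup>2 *
      eta_abs \<beta> \<eta> (u::real^'n::finite) powr (- real CARD('n) - real_of_ereal \<alpha> + \<beta>)) \<partial>lborel) \<le> ennreal (tail_const C)"
  using assms(1)[unfolded mode_scaling_def Let_def, THEN conjunct2, THEN mp, OF assms(2)]
  by (elim conjE) (drule mp[OF _ assms(3)], drule bspec[OF _ assms(5)], drule bspec[OF _ assms(4)], assumption)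

text \<open>That \<open>eta0 C\<close> is positive, so that small \<open>\<eta>\<close> fall in the
  range of the hypotheses, is known only from an admissible datum. Without any datum the claim is
  vacuous; hence nonemptiness may be assumed, and other constants such as \<open>eta1 C\<close> are
  shown positive in the same way.\<close>

lemma eventually_admissible:
  assumes "admissible C \<alpha> \<beta> lam \<noteq> {} \<Longrightarrow>
    eventually (\<lambda>\<eta>. \<eta> \<in> {0<..<eta0 C} \<longrightarrow> (\<forall>x\<in>admissible C \<alpha> \<beta> lam. P \<eta> x)) (at_right 0)"
  shows "eventually (\<lambda>\<eta>. \<forall>x\<in>admissible C \<alpha> \<beta> lam. P \<eta> x) (at_right 0)"
proof (cases "admissible C \<alpha> \<beta> lam = {}")
  case False
  then obtain M \<phi> \<mu> \<mu>0 L Dt where "fluid_mode C \<alpha> \<beta> lam M L Dt \<phi> \<mu> \<mu>0"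
    unfolding admissible_def by blast
  then have "eventually (\<lambda>\<eta>. \<eta> \<in> {0<..<eta0 C}) (at_right 0)"
    by (intro eventually_at_right_real fluid_mode_eta0_pos)
  then show ?thesis using assms[OF False] by eventually_elim blast
qed simp

section \<open>Passage between the velocity and the rescaled variable\<close>

text \<open>With \<open>s = \<eta> powr (1 / (1 + \<beta>))\<close>, the square
  \<open>s\<^sup>2\<close> factors out under the root. The substitution
  \<open>u = s *\<^sub>R v\<close> thus translates hypotheses on the rescaled mode into bounds on
  the mode itself.\<close>

lemma eta_abs_scaleR:
  assumes "\<eta> > 0" "1 + \<beta> > 0"
  shows "eta_abs \<beta> \<eta> ((\<eta> powr (1 / (1 + \<beta>))) *\<^sub>R v) = \<eta> powr (1 / (1 + \<beta>)) * jap v"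
proof -
  have "\<eta> powr (2 / (1 + \<beta>)) = (\<eta> powr (1 / (1 + \<beta>)))\<^sup>2"
    by (simp add: power2_eq_square powr_add[symmetric])
  then have "\<eta> powr (2 / (1 + \<beta>)) + (norm ((\<eta> powr (1 / (1 + \<beta>))) *\<^sub>R v))\<^sup>2 =
     (\<eta> powr (1 / (1 + \<beta>)))\<^sup>2 * (1 + (norm v)\<^sup>2)"
    by (simp add: power_mult_distrib algebra_simps)
  then show ?thesis unfolding eta_abs_def jap_def by (simp add: real_sqrt_mult)
qed

lemma rescaled_scaleR:
  assumes "\<eta> > 0"
  shows "rescaled \<beta> \<phi> \<eta> \<sigma> ((\<eta> powr (1 / (1 + \<beta>))) *\<^sub>R v) = \<phi> \<eta> \<sigma> v"
  using assms unfolding rescaled_def by (simp add: powr_add[symmetric])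

lemma nn_integral_lborel_scaleR:
  fixes f :: "'a::euclidean_space \<Rightarrow> ennreal"
  assumes [measurable]: "f \<in> borel_measurable borel" and "c > 0"
  shows "(\<integral>\<^sup>+u. f u \<partial>lborel) = ennreal (c ^ DIM('a)) * (\<integral>\<^sup>+v. f (c *\<^sub>R v) \<partial>lborel)"
proof -
  have "(\<integral>\<^sup>+u. f u \<partial>lborel) = (\<integral>\<^sup>+u. f u \<partial>density (distr lborel borel (\<lambda>x. 0 + c *\<^sub>R x)) (\<lambda>_. \<bar>c\<bar> ^ DIM('a)))"
    using arg_cong[OF lborel_affine[of c "0::'a"], of "\<lambda>m. nn_integral m f"] assms(2) by blast
  also have "\<dots> = ennreal (c ^ DIM('a)) * (\<integral>\<^sup>+v. f (c *\<^sub>R v) \<partial>lborel)"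
    using assms(2) by (simp add: nn_integral_density nn_integral_distr nn_integral_cmult)
  finally show ?thesis .
qed

text \<open>A dilation multiplies Lebesgue measure by a positive constant, so it preserves null
  sets.\<close>

lemma AE_lborel_scaleR:
  fixes P :: "'a::euclidean_space \<Rightarrow> bool"
  assumes "AE u in lborel. P u" "c > 0"
  shows "AE v in lborel. P (c *\<^sub>R v)"
proof -
  have "AE u in density (distr lborel borel (\<lambda>x::'a. 0 + c *\<^sub>R x)) (\<lambda>_. \<bar>c\<bar> ^ DIM('a)). P u"
    using assms(1) by (subst (asm) lborel_affine[of c "0::'a"]) (use assms(2) in auto)
  then have "AE u in distr lborel borel (\<lambda>x::'a. 0 + c *\<^sub>R x). P u"
    using assms(2) by (subst (asm) AE_density) auto
  from AE_distrD[OF _ this] show ?thesis by simp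
qed

section \<open>The mass of the mode and its limit for positive \<open>\<alpha>\<close>\<close>

text \<open>On \<open>S\<close> the conjugate of \<open>f\<close> is split as 1 plus the conjugate
  of \<open>f - 1\<close>, and on the complement it is kept whole. The set \<open>S\<close> is where
  closeness of the mode to 1 is usable; elsewhere only size bounds are.\<close>

lemma scal_one_approx:
  assumes [measurable]: "M \<in> borel_measurable borel" "f \<in> borel_measurable borel" "S \<in> sets borel"
    and M: "\<And>v. M v \<ge> 0"
    and i1: "integrable lborel (\<lambda>v. cmod (f v - 1) * M v * indicator S v)"
    and i2: "integrable lborel (\<lambda>v. M v * indicator S v)"
    and i3: "integrable lborel (\<lambda>v. cmod (f v) * M v * indicator (- S) v)"
  shows "cmod (scal M (\<lambda>_. 1) f - of_real (\<integral>v. M v * indicator S v \<partial>lborel)) \<le>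
    (\<integral>v. cmod (f v - 1) * M v * indicator S v \<partial>lborel) + (\<integral>v. cmod (f v) * M v * indicator (- S) v \<partial>lborel)"
proof -
  have [measurable]: "cnj \<in> borel_measurable borel"
    by (intro borel_measurable_continuous_onI continuous_intros)
  let ?g = "\<lambda>v. cnj (f v - 1) * of_real (M v * indicator S v)"
  let ?h = "\<lambda>v. cnj (f v) * of_real (M v * indicator (- S) v)"
  let ?m = "\<lambda>v. complex_of_real (M v * indicator S v)"
  have ng: "cmod (?g v) = cmod (f v - 1) * M v * indicator S v" for v
    using M[of v] by (simp only: norm_mult complex_mod_cnj norm_of_real) (simp split: split_indicator)
  have nh: "cmod (?h v) = cmod (f v) * M v * indicator (- S) v" for v
    using M[of v] by (simp only: norm_mult complex_mod_cnj norm_of_real) (simp split: split_indicator)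
  have g: "integrable lborel ?g"
    by (rule Bochner_Integration.integrable_bound[OF i1]) (measurable, unfold ng, simp)
  have h: "integrable lborel ?h"
    by (rule Bochner_Integration.integrable_bound[OF i3]) (measurable, unfold nh, simp)
  have m: "integrable lborel ?m" using i2 by (rule integrable_of_real)
  have "scal M (\<lambda>_. 1) f = (\<integral>v. ?m v + (?g v + ?h v) \<partial>lborel)"
    unfolding scal_def by (intro Bochner_Integration.integral_cong) (auto simp: algebra_simps split: split_indicator)
  also have "\<dots> = of_real (\<integral>v. M v * indicator S v \<partial>lborel) + (integral\<^sup>L lborel ?g + integral\<^sup>L lborel ?h)"
    using g h m by (simp only: Bochner_Integration.integral_add Bochner_Integration.integrable_add integral_complex_of_real)
  finally have "scal M (\<lambda>_. 1) f - of_real (\<integral>v. M v * indicator S v \<partial>lborel) = integral\<^sup>L lborel ?g + integral\<^sup>L lborel ?h"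
    by simp
  also have "cmod \<dots> \<le> (\<integral>v. cmod (?g v) \<partial>lborel) + (\<integral>v. cmod (?h v) \<partial>lborel)"
    by (intro norm_triangle_le add_mono integral_norm_bound)
  finally show ?thesis by (simp only: ng nh)
qed

definition mode_mass ::
  "real ^ 'n::finite \<Rightarrow> real \<Rightarrow>
   (real ^ 'n \<Rightarrow> real) \<times> (real \<Rightarrow> real ^ 'n \<Rightarrow> real ^ 'n \<Rightarrow> complex) \<times> (real \<Rightarrow> real) \<times> real \<Rightarrow> complex" where
  "mode_mass \<sigma> \<eta> = (\<lambda>(M, \<phi>, \<mu>, \<mu>0). scal M (\<lambda>_. 1) (\<phi> \<eta> \<sigma>))"

text \<open>Since \<open>\<beta> < \<alpha>\<close>, the \<open>\<beta>\<close>-moment of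
  \<open>M\<close> is finite and bounded uniformly in \<open>M\<close>, so no truncation is
  necessary and \<open>S\<close> is the whole space.\<close>

lemma mode_mass_limit_light:
  fixes \<sigma> :: "real ^ 'n::finite"
  assumes \<alpha>: "\<alpha> + ereal \<beta> > 0" "\<alpha> > 0" and \<sigma>: "\<sigma> \<in> sphere 0 1" and less: "ereal \<beta> < \<alpha>"
  shows "uniform_limit (admissible C \<alpha> \<beta> lam) (mode_mass \<sigma>) (\<lambda>(M, _). of_real (\<integral>v. M v \<partial>lborel)) (at_right 0)"
proof (rule uniform_limitI, rule eventually_admissible)
  fix e :: real assume "e > 0"
  have \<alpha>0: "\<alpha> \<ge> 0" using \<alpha> by simp
  obtain B where B: "\<And>M. equilibrium C \<alpha> \<beta> M \<Longrightarrow>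
      integrable lborel (\<lambda>v::real^'n. jap v powr \<beta> * M v) \<and> (\<integral>v. jap v powr \<beta> * M v \<partial>lborel) \<le> B"
    using equilibrium_moment_bound[OF \<alpha>0 less, of C \<beta>] by blast
  have "((\<lambda>\<eta>. mode_error C \<alpha> \<beta> \<eta> * sqrt B) \<longlongrightarrow> 0) (at_right 0)"
    using tendsto_mult[OF tendsto_mode_error[OF \<alpha>(1) \<alpha>0, of C] tendsto_const[of "sqrt B"]] by simp
  then have "eventually (\<lambda>\<eta>. mode_error C \<alpha> \<beta> \<eta> * sqrt B < e) (at_right 0)"
    using \<open>e > 0\<close> by (rule order_tendstoD)
  then show "eventually (\<lambda>\<eta>. \<eta> \<in> {0<..<eta0 C} \<longrightarrow> (\<forall>x\<in>admissible C \<alpha> \<beta> lam.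
      dist (mode_mass \<sigma> \<eta> x) (case x of (M, _) \<Rightarrow> of_real (\<integral>v. M v \<partial>lborel)) < e)) (at_right 0)"
  proof (eventually_elim, intro impI ballI)
    fix \<eta> x
    assume small: "mode_error C \<alpha> \<beta> \<eta> * sqrt B < e" and \<eta>: "\<eta> \<in> {0<..<eta0 C}" and x: "x \<in> admissible C \<alpha> \<beta> lam"
    obtain M \<phi> \<mu> \<mu>0 where xe: "x = (M, \<phi>, \<mu>, \<mu>0)" by (cases x)
    obtain L Dt \<Phi> \<Omega> where M: "equilibrium C \<alpha> \<beta> M" and fm: "fluid_mode C \<alpha> \<beta> lam M L Dt \<phi> \<mu> \<mu>0"
      using x unfolding xe by (rule admissible_D)
    note b = fluid_mode_bounds[OF fm \<eta> \<sigma>]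
    have fm: "\<phi> \<eta> \<sigma> \<in> borel_measurable borel" using b(1) by (simp add: L2w_def)
    have Mi: "integrable lborel M" by (rule equilibrium_integrable[OF M \<alpha>(2)])
    have w: "integrable lborel (\<lambda>v. jap v powr \<beta> * M v * indicator UNIV v)" using B[OF M] by simp
    note d = L2w_diff_one_bound[OF equilibrium_measurable[OF M \<alpha>0] equilibrium_nonneg[OF M \<alpha>0]
        equilibrium_normalised(1)[OF M] b(1) _ w]
    have "cmod (scal M (\<lambda>_. 1) (\<phi> \<eta> \<sigma>) - of_real (\<integral>v. M v * indicator UNIV v \<partial>lborel)) \<le>
      (\<integral>v. cmod (\<phi> \<eta> \<sigma> v - 1) * M v * indicator UNIV v \<partial>lborel) + (\<integral>v. cmod (\<phi> \<eta> \<sigma> v) * M v * indicator (- UNIV) v \<partial>lborel)"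
      by (rule scal_one_approx[OF equilibrium_measurable[OF M \<alpha>0] fm _ equilibrium_nonneg[OF M \<alpha>0] d(1)])
        (use Mi in simp_all)
    also have "\<dots> = (\<integral>v. cmod (\<phi> \<eta> \<sigma> v - 1) * M v * indicator UNIV v \<partial>lborel)" by simp
    also have "\<dots> \<le> normw M (- \<beta>) (\<lambda>v. \<phi> \<eta> \<sigma> v - 1) * sqrt (\<integral>v. jap v powr \<beta> * M v * indicator UNIV v \<partial>lborel)"
      by (rule d(2)) simp
    also have "\<dots> \<le> mode_error C \<alpha> \<beta> \<eta> * sqrt B"
    proof (rule mult_mono)
      show "normw M (- \<beta>) (\<lambda>v. \<phi> \<eta> \<sigma> v - 1) \<le> mode_error C \<alpha> \<beta> \<eta>" by (rule b(4))
      show "sqrt (\<integral>v. jap v powr \<beta> * M v * indicator UNIV v \<partial>lborel) \<le> sqrt B" using B[OF M] by simp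
      show "0 \<le> mode_error C \<alpha> \<beta> \<eta>" using b(2,3) unfolding mode_error_def by (intro mult_nonneg_nonneg) auto
      show "0 \<le> sqrt (\<integral>v. jap v powr \<beta> * M v * indicator UNIV v \<partial>lborel)"
        using equilibrium_nonneg[OF M \<alpha>0] by simp
    qed
    also note small
    finally show "dist (mode_mass \<sigma> \<eta> x) (case x of (M, _) \<Rightarrow> of_real (\<integral>v. M v \<partial>lborel)) < e"
      by (simp add: xe mode_mass_def dist_norm)
  qed
qed

text \<open>The growth bound reads \<open>(s * jap v) powr (growth_exp C * \<mu> \<eta>)\<close> in
  the velocity variable, and \<open>s \<le> 1\<close> because \<open>\<eta> < 1\<close>. As
  \<open>\<mu> \<eta>\<close> tends to 0, \<open>q\<close> can be taken as small as desired, which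
  is what makes the mode integrable against \<open>M\<close>.\<close>

lemma mode_pointwise_bound:
  fixes \<sigma> :: "real ^ 'n::finite"
  assumes ms: "mode_scaling C \<alpha> \<beta> M \<phi> \<mu> \<Phi> \<Omega>" and le: "\<alpha> \<le> ereal (2 + \<beta>)" and pos: "1 + \<beta> > 0"
    and \<sigma>: "\<sigma> \<in> sphere 0 1" and \<eta>: "\<eta> \<in> {0<..<eta1 C}" "\<eta> < 1"
    and q: "0 < \<mu> \<eta>" "growth_exp C * \<mu> \<eta> \<le> q"
  shows "AE v in lborel. cmod (\<phi> \<eta> \<sigma> v) \<le> \<bar>growth_const C\<bar> * jap v powr q"
proof -
  define s where "s = \<eta> powr (1 / (1 + \<beta>))"
  have s: "0 < s" "s \<le> 1" using \<eta> pos powr_mono2[of "1 / (1 + \<beta>)" \<eta> 1] by (auto simp: s_def)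
  have "AE u in lborel. cmod (rescaled \<beta> \<phi> \<eta> \<sigma> u) \<le> growth_const C * eta_abs \<beta> \<eta> u powr (growth_exp C * \<mu> \<eta>)"
    by (rule mode_scaling_growth(3)[OF ms le \<sigma> \<eta>(1)])
  from AE_lborel_scaleR[OF this s(1)]
  show ?thesis
  proof eventually_elim
    case (elim v)
    have "cmod (\<phi> \<eta> \<sigma> v) \<le> growth_const C * (s * jap v) powr (growth_exp C * \<mu> \<eta>)"
      using elim \<eta> pos by (simp add: s_def rescaled_scaleR eta_abs_scaleR)
    also have "\<dots> \<le> \<bar>growth_const C\<bar> * jap v powr q"
    proof (rule mult_mono)
      have "(s * jap v) powr (growth_exp C * \<mu> \<eta>) \<le> jap v powr (growth_exp C * \<mu> \<eta>)"
        using s jap_pos[of v] mode_scaling_growth(2)[OF ms le] q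
        by (intro powr_mono2) (auto simp: mult_left_le_one_le)
      also have "\<dots> \<le> jap v powr q" using one_le_jap[of v] q by (intro powr_mono) auto
      finally show "(s * jap v) powr (growth_exp C * \<mu> \<eta>) \<le> jap v powr q" .
    qed auto
    finally show ?case .
  qed
qed

text \<open>The \<open>\<beta>\<close>-moment of \<open>M\<close> diverges here, so space is cut at
  a radius \<open>R\<close> chosen in terms of \<open>e\<close> and the constants. Outside, the mode
  is dominated by \<open>jap powr (a / 2)\<close>, leaving a tail of order
  \<open>R powr (- (a / 2))\<close>; inside, the deviation from 1 tends to 0 for fixed
  \<open>R\<close>.\<close>

lemma mode_mass_limit_heavy:
  fixes \<sigma> :: "real ^ 'n::finite"
  assumes a: "a > 0" "a \<le> \<beta>" and \<sigma>: "\<sigma> \<in> sphere 0 1"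
  shows "uniform_limit (admissible C (ereal a) \<beta> lam) (mode_mass \<sigma>) (\<lambda>(M, _). of_real (\<integral>v. M v \<partial>lborel)) (at_right 0)"
proof (rule uniform_limitI, rule eventually_admissible)
  fix e :: real assume "e > 0" and ne: "admissible C (ereal a) \<beta> lam \<noteq> {}"
  have \<alpha>: "ereal a + ereal \<beta> > 0" "ereal a \<ge> 0" "ereal a \<le> ereal (2 + \<beta>)" "1 + \<beta> > 0" using a by auto
  define c where "c = eq_const TYPE('n) a \<beta>"
  define S where "S = sphere_area TYPE('n)"
  define G where "G = \<bar>growth_const C\<bar>"
  have c: "c \<ge> 0" unfolding c_def by (rule eq_const_nonneg)
  \<comment> \<open>Two tails have to be small outside the ball: that of the mode, which accounts
    for \<open>G\<close>, and that of \<open>M\<close> itself, which accounts for the 1.\<close>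
  have "((\<lambda>R. (G + 1) * (c * (S / (a / 2) * R powr (- (a / 2))))) \<longlongrightarrow> (G + 1) * (c * (S / (a / 2) * 0))) at_top"
    using a by (intro tendsto_mult tendsto_const tendsto_neg_powr filterlim_ident) auto
  then have "((\<lambda>R. (G + 1) * (c * (S / (a / 2) * R powr (- (a / 2))))) \<longlongrightarrow> 0) at_top" by simp
  then have "eventually (\<lambda>R. (G + 1) * (c * (S / (a / 2) * R powr (- (a / 2)))) < e / 2) at_top"
    using \<open>e > 0\<close> by (intro order_tendstoD(2)) auto
  then have "eventually (\<lambda>R. (G + 1) * (c * (S / (a / 2) * R powr (- (a / 2)))) < e / 2 \<and> R \<ge> 1) at_top"
    using eventually_ge_at_top[of "1::real"] by eventually_elim simp
  then obtain R where R: "(G + 1) * (c * (S / (a / 2) * R powr (- (a / 2)))) < e / 2" "R \<ge> 1"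
    using eventually_happens'[OF trivial_limit_at_top_linorder] by blast
  \<comment> \<open>The \<open>\<beta>\<close>-moment over the ball may grow with \<open>R\<close>,
    which is why \<open>R\<close> is fixed before \<open>\<eta>\<close> is sent to 0.\<close>
  define W where "W = (\<integral>(v::real^'n). jap v powr \<beta> * (c * jap v powr (- (real CARD('n) + a))) * indicator (ball 0 R) v \<partial>lborel)"
  have eta1: "eta1 C > 0"
  proof -
    from ne obtain M \<phi> \<mu> \<mu>0 \<Phi> \<Omega> where "mode_scaling C (ereal a) \<beta> M \<phi> \<mu> \<Phi> \<Omega>"
      unfolding admissible_def by blast
    from mode_scaling_growth(1)[OF this \<alpha>(3)] show ?thesis .
  qed
  have "((\<lambda>\<eta>. mode_error C (ereal a) \<beta> \<eta> * sqrt W) \<longlongrightarrow> 0) (at_right 0)"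
    using tendsto_mult[OF tendsto_mode_error[OF \<alpha>(1,2), of C] tendsto_const[of "sqrt W"]] by simp
  then have "eventually (\<lambda>\<eta>. mode_error C (ereal a) \<beta> \<eta> * sqrt W < e / 2) (at_right 0)"
    using \<open>e > 0\<close> by (intro order_tendstoD(2)) auto
  moreover have "((\<lambda>\<eta>. growth_exp C * (theta_upper C * Theta (ereal a) \<beta> \<eta>)) \<longlongrightarrow> 0) (at_right 0)"
    using tendsto_mult[OF tendsto_const tendsto_mult[OF tendsto_const tendsto_Theta[OF \<alpha>(1,2)]]] by simp
  \<comment> \<open>Half of the decay exponent \<open>a\<close> is given to the growth of the mode;
    the other half keeps the tail integrable.\<close>
  then have "eventually (\<lambda>\<eta>. growth_exp C * (theta_upper C * Theta (ereal a) \<beta> \<eta>) < a / 2) (at_right 0)"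
    using a by (intro order_tendstoD(2)) auto
  moreover have "eventually (\<lambda>\<eta>. \<eta> \<in> {0<..<min (eta1 C) 1}) (at_right 0)"
    using eta1 by (intro eventually_at_right_real) auto
  ultimately
  show "eventually (\<lambda>\<eta>. \<eta> \<in> {0<..<eta0 C} \<longrightarrow> (\<forall>x\<in>admissible C (ereal a) \<beta> lam.
      dist (mode_mass \<sigma> \<eta> x) (case x of (M, _) \<Rightarrow> of_real (\<integral>v. M v \<partial>lborel)) < e)) (at_right 0)"
  proof (eventually_elim, intro impI ballI)
    fix \<eta> x
    assume small: "mode_error C (ereal a) \<beta> \<eta> * sqrt W < e / 2"
      "growth_exp C * (theta_upper C * Theta (ereal a) \<beta> \<eta>) < a / 2"
      and \<eta>1: "\<eta> \<in> {0<..<min (eta1 C) 1}"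
      and \<eta>: "\<eta> \<in> {0<..<eta0 C}" and x: "x \<in> admissible C (ereal a) \<beta> lam"
    obtain M \<phi> \<mu> \<mu>0 where xe: "x = (M, \<phi>, \<mu>, \<mu>0)" by (cases x)
    obtain L Dt \<Phi> \<Omega> where M: "equilibrium C (ereal a) \<beta> M" and fm: "fluid_mode C (ereal a) \<beta> lam M L Dt \<phi> \<mu> \<mu>0"
      and ms: "mode_scaling C (ereal a) \<beta> M \<phi> \<mu> \<Phi> \<Omega>"
      using x unfolding xe by (rule admissible_D)
    have Me: "M = (\<lambda>v. c * jap v powr (- (real CARD('n) + a)))"
      unfolding c_def by (rule equilibrium_finite[OF M])
    note b = fluid_mode_bounds[OF fm \<eta> \<sigma>]
    note Mn = equilibrium_nonneg[OF M \<alpha>(2)]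
    note Mm [measurable] = equilibrium_measurable[OF M \<alpha>(2)]
    have fm [measurable]: "\<phi> \<eta> \<sigma> \<in> borel_measurable borel" using b(1) by (simp add: L2w_def)
    have "growth_exp C * \<mu> \<eta> \<le> growth_exp C * (theta_upper C * Theta (ereal a) \<beta> \<eta>)"
      using b(3) mode_scaling_growth(2)[OF ms \<alpha>(3)] by (intro mult_left_mono) auto
    then have "growth_exp C * \<mu> \<eta> \<le> a / 2" using small(2) by linarith
    from mode_pointwise_bound[OF ms \<alpha>(3,4) \<sigma> _ _ b(2) this] \<eta>1
    have pw: "AE v in lborel. cmod (\<phi> \<eta> \<sigma> v) \<le> G * jap v powr (a / 2)" unfolding G_def by simp
    have Mb: "jap v powr \<beta> * M v * indicator (ball 0 R) v =
        c * (jap v powr (\<beta> - (real CARD('n) + a)) * indicator (ball 0 R) v)" for v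
    proof -
      have e: "\<beta> - (real CARD('n) + a) = \<beta> + - (real CARD('n) + a)" by simp
      show ?thesis unfolding Me e powr_add by (simp only: mult_ac)
    qed
    have w: "integrable lborel (\<lambda>v. jap v powr \<beta> * M v * indicator (ball 0 R) v)"
      unfolding Mb by (intro integrable_mult_right integrable_jap_ball)
    note d = L2w_diff_one_bound[OF Mm Mn equilibrium_normalised(1)[OF M] b(1) _ w]
    let ?t = "\<lambda>v::real^'n. c * (jap v powr (- real CARD('n) - a / 2) * indicator (- ball 0 R) v)"
    have ti: "integrable lborel ?t"
      using a by (intro integrable_mult_right integrable_real_mult_indicator integrable_jap_powr) auto
    have tle: "integral\<^sup>L lborel ?t \<le> c * (S / (a / 2) * R powr (- (a / 2)))"
    proof -
      have "(\<integral>(v::real^'n). jap v powr (- real CARD('n) - a / 2) * indicator (- ball 0 R) v \<partial>lborel)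
          \<le> S / (a / 2) * R powr (- (a / 2))"
        unfolding S_def using a R by (intro integral_jap_tail_le) auto
      from mult_left_mono[OF this c] show ?thesis by (simp only: integral_mult_right_zero)
    qed
    have Mt: "jap v powr (a / 2) * M v * indicator (- ball 0 R) v = ?t v" for v
    proof -
      have e: "- real CARD('n) - a / 2 = a / 2 + - (real CARD('n) + a)" by (simp add: field_simps)
      show ?thesis unfolding Me e powr_add by (simp only: mult_ac)
    qed
    \<comment> \<open>As \<open>jap powr (a / 2)\<close> is at least 1, the majorant
      \<open>?t\<close> for the mode also controls the tail of \<open>M\<close>.\<close>
    have Mt1: "M v * indicator (- ball 0 R) v \<le> ?t v" for v
    proof -
      have "1 * (M v * indicator (- ball 0 R) v) \<le> jap v powr (a / 2) * (M v * indicator (- ball 0 R) v)"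
        using Mn[of v] one_le_jap[of v] a by (intro mult_right_mono ge_one_powr_ge_zero) auto
      then show ?thesis unfolding Mt[symmetric] by (simp add: mult_ac)
    qed
    have Mi: "integrable lborel M"
      unfolding Me using a by (intro integrable_mult_right integrable_jap_powr) auto
    have Mi1: "integrable lborel (\<lambda>v. M v * indicator (ball 0 R) v)"
      and Mi2: "integrable lborel (\<lambda>v. M v * indicator (- ball 0 R) v)"
      by (rule integrable_real_mult_indicator[OF _ Mi]; simp)+
    have ple: "AE v in lborel. cmod (\<phi> \<eta> \<sigma> v) * M v * indicator (- ball 0 R) v \<le> G * ?t v"
      using pw
    proof eventually_elim
      case (elim v)
      have "cmod (\<phi> \<eta> \<sigma> v) * (M v * indicator (- ball 0 R) v) \<le> G * jap v powr (a / 2) * (M v * indicator (- ball 0 R) v)"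
        using elim Mn[of v] by (intro mult_right_mono) auto
      then show ?case unfolding Mt[symmetric] by (simp only: mult_ac)
    qed
    have pi: "integrable lborel (\<lambda>v. cmod (\<phi> \<eta> \<sigma> v) * M v * indicator (- ball 0 R) v)"
    proof (rule Bochner_Integration.integrable_bound)
      show "integrable lborel (\<lambda>v. G * ?t v)" using ti by (rule integrable_mult_right)
      show "AE v in lborel. norm (cmod (\<phi> \<eta> \<sigma> v) * M v * indicator (- ball 0 R) v) \<le> norm (G * ?t v)"
        using ple
      proof eventually_elim
        case (elim v)
        have "norm (cmod (\<phi> \<eta> \<sigma> v) * M v * indicator (- ball 0 R) v) = cmod (\<phi> \<eta> \<sigma> v) * M v * indicator (- ball 0 R) v"
          using Mn[of v] by simp
        with elim show ?case unfolding real_norm_def by linarith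
      qed
    qed measurable
    have split: "(\<integral>v. M v \<partial>lborel) = (\<integral>v. M v * indicator (ball 0 R) v \<partial>lborel) + (\<integral>v. M v * indicator (- ball 0 R) v \<partial>lborel)"
      by (subst Bochner_Integration.integral_add[OF Mi1 Mi2, symmetric])
         (auto intro!: Bochner_Integration.integral_cong split: split_indicator)
    have tail: "0 \<le> (\<integral>v. M v * indicator (- ball 0 R) v \<partial>lborel)"
      using Mn by (intro Bochner_Integration.integral_nonneg) simp
    have tail_le: "(\<integral>v. M v * indicator (- ball 0 R) v \<partial>lborel) \<le> integral\<^sup>L lborel ?t"
      by (rule integral_mono[OF Mi2 ti Mt1])
    have in1: "(\<integral>v. cmod (\<phi> \<eta> \<sigma> v - 1) * M v * indicator (ball 0 R) v \<partial>lborel) \<le> mode_error C (ereal a) \<beta> \<eta> * sqrt W"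
    proof -
      have "(\<integral>v. cmod (\<phi> \<eta> \<sigma> v - 1) * M v * indicator (ball 0 R) v \<partial>lborel) \<le>
        normw M (- \<beta>) (\<lambda>v. \<phi> \<eta> \<sigma> v - 1) * sqrt (\<integral>v. jap v powr \<beta> * M v * indicator (ball 0 R) v \<partial>lborel)"
        by (rule d(2)) simp
      also have "(\<integral>v. jap v powr \<beta> * M v * indicator (ball 0 R) v \<partial>lborel) = W" unfolding W_def Me ..
      also have "normw M (- \<beta>) (\<lambda>v. \<phi> \<eta> \<sigma> v - 1) * sqrt W \<le> mode_error C (ereal a) \<beta> \<eta> * sqrt W"
      proof (rule mult_right_mono[OF b(4)])
        show "0 \<le> sqrt W" unfolding W_def using c by (intro real_sqrt_ge_zero Bochner_Integration.integral_nonneg) simp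
      qed
      finally show ?thesis .
    qed
    have in2: "(\<integral>v. cmod (\<phi> \<eta> \<sigma> v) * M v * indicator (- ball 0 R) v \<partial>lborel) \<le> G * integral\<^sup>L lborel ?t"
      using integral_mono_AE[OF pi integrable_mult_right[OF ti, of G] ple] by (simp only: integral_mult_right_zero)
    have "cmod (scal M (\<lambda>_. 1) (\<phi> \<eta> \<sigma>) - of_real (\<integral>v. M v * indicator (ball 0 R) v \<partial>lborel)) \<le>
      (\<integral>v. cmod (\<phi> \<eta> \<sigma> v - 1) * M v * indicator (ball 0 R) v \<partial>lborel) + (\<integral>v. cmod (\<phi> \<eta> \<sigma> v) * M v * indicator (- ball 0 R) v \<partial>lborel)"
      by (rule scal_one_approx[OF Mm fm _ Mn d(1) Mi1 pi]) auto
    also have "\<dots> \<le> mode_error C (ereal a) \<beta> \<eta> * sqrt W + G * integral\<^sup>L lborel ?t"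
      using in1 in2 by linarith
    finally have 1: "cmod (scal M (\<lambda>_. 1) (\<phi> \<eta> \<sigma>) - of_real (\<integral>v. M v * indicator (ball 0 R) v \<partial>lborel)) \<le> \<dots>" .
    have 2: "cmod (complex_of_real (\<integral>v. M v * indicator (ball 0 R) v \<partial>lborel) - of_real (\<integral>v. M v \<partial>lborel)) \<le> integral\<^sup>L lborel ?t"
      using tail tail_le unfolding split of_real_diff[symmetric] norm_of_real by simp
    have "cmod (scal M (\<lambda>_. 1) (\<phi> \<eta> \<sigma>) - of_real (\<integral>v. M v \<partial>lborel)) \<le>
      mode_error C (ereal a) \<beta> \<eta> * sqrt W + (G + 1) * integral\<^sup>L lborel ?t"
      using norm_diff_triangle_le[OF 1 2] by (simp add: algebra_simps)
    also have "(G + 1) * integral\<^sup>L lborel ?t \<le> (G + 1) * (c * (S / (a / 2) * R powr (- (a / 2))))"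
      using tle by (rule mult_left_mono) (simp add: G_def)
    finally show "dist (mode_mass \<sigma> \<eta> x) (case x of (M, _) \<Rightarrow> of_real (\<integral>v. M v \<partial>lborel)) < e"
      using small(1) R(1) by (simp add: xe mode_mass_def dist_norm)
  qed
qed

section \<open>The mass of the mode for \<open>\<alpha> = 0\<close>\<close>

text \<open>The tail hypothesis transported to velocities: with \<open>u = s *\<^sub>R v\<close> and
  \<open>R = inverse s\<close>, the region \<open>norm u \<ge> 1\<close> becomes the complement of
  the ball of radius \<open>R\<close>.\<close>

lemma mode_tail_bound:
  fixes \<sigma> :: "real ^ 'n::finite"
  assumes ms: "mode_scaling C (ereal 0) \<beta> M \<phi> \<mu> \<Phi> \<Omega>" and \<beta>: "\<beta> > 0"
    and \<sigma>: "\<sigma> \<in> sphere 0 1" and \<eta>: "\<eta> \<in> {0<..<eta1 C}"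
    and [measurable]: "\<phi> \<eta> \<sigma> \<in> borel_measurable borel"
  defines "R \<equiv> \<eta> powr (- 1 / (1 + \<beta>))"
  shows "(\<integral>\<^sup>+v. ennreal ((cmod (\<phi> \<eta> \<sigma> v))\<^sup>2 * jap v powr (- real CARD('n) + \<beta>) * indicator (- ball 0 R) v) \<partial>lborel)
    \<le> ennreal (R powr \<beta> * max 0 (tail_const C))"
proof -
  let ?d = "real CARD('n)"
  define s where "s = \<eta> powr (1 / (1 + \<beta>))"
  have s: "s > 0" "R = inverse s" "R > 0" using \<eta> by (auto simp: s_def R_def powr_minus)
  have scaled: "rescaled \<beta> \<phi> \<eta> \<sigma> (s *\<^sub>R v) = \<phi> \<eta> \<sigma> v" "eta_abs \<beta> \<eta> (s *\<^sub>R v) = s * jap v" for v :: "real^'n"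
    using \<eta> \<beta> unfolding s_def by (simp_all add: rescaled_scaleR eta_abs_scaleR)
  have [measurable]: "(\<lambda>u. rescaled \<beta> \<phi> \<eta> \<sigma> u) \<in> borel_measurable borel"
    unfolding rescaled_def by measurable
  have [measurable]: "(\<lambda>u. eta_abs \<beta> \<eta> (u :: real^'n)) \<in> borel_measurable borel"
    unfolding eta_abs_def by measurable
  let ?T = "\<lambda>v. ennreal ((cmod (\<phi> \<eta> \<sigma> v))\<^sup>2 * jap v powr (- ?d + \<beta>) * indicator (- ball 0 R) v)"
  \<comment> \<open>The Jacobian \<open>s ^ CARD('n)\<close> and the factor
    \<open>s powr (- ?d + \<beta>)\<close> from the weight combine to \<open>s powr \<beta>\<close>,
    the inverse of the factor in the claim.\<close>
  have "ennreal (s powr \<beta>) * (\<integral>\<^sup>+v. ?T v \<partial>lborel) = ennreal (s ^ CARD('n)) *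
    (\<integral>\<^sup>+v. ennreal (s powr (- ?d + \<beta>)) * ?T v \<partial>lborel)"
  proof -
    have "s powr \<beta> = s ^ CARD('n) * s powr (- ?d + \<beta>)"
      using s by (simp add: powr_realpow[symmetric] powr_add[symmetric])
    then show ?thesis
      using s by (subst nn_integral_cmult) (simp_all add: ennreal_mult mult.assoc)
  qed
  also have "\<dots> = ennreal (s ^ CARD('n)) * (\<integral>\<^sup>+v. ennreal ((cmod (rescaled \<beta> \<phi> \<eta> \<sigma> (s *\<^sub>R v)))\<^sup>2 *
      eta_abs \<beta> \<eta> (s *\<^sub>R v :: real^'n) powr (- ?d - real_of_ereal (ereal 0) + \<beta>)) * indicator {u. norm u \<ge> 1} (s *\<^sub>R v) \<partial>lborel)"
  proof (rule arg_cong[where f="(*) _"], rule nn_integral_cong)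
    fix v :: "real^'n"
    have "(1 \<le> s * x) = (R \<le> x)" for x using s(1) unfolding s(2) by (simp add: field_simps)
    then have "(1 \<le> norm (s *\<^sub>R v)) = (v \<in> - ball 0 R)" using s(1) by (simp add: not_less)
    then have i: "indicator {u. norm u \<ge> 1} (s *\<^sub>R v) = (indicator (- ball 0 R) v :: ennreal)"
      by (simp add: indicator_def)
    show "ennreal (s powr (- ?d + \<beta>)) * ?T v = ennreal ((cmod (rescaled \<beta> \<phi> \<eta> \<sigma> (s *\<^sub>R v)))\<^sup>2 *
      eta_abs \<beta> \<eta> (s *\<^sub>R v) powr (- ?d - real_of_ereal (ereal 0) + \<beta>)) * indicator {u. norm u \<ge> 1} (s *\<^sub>R v)"
      unfolding scaled i using s jap_pos[of v]
      by (simp add: powr_mult ennreal_mult'[symmetric] mult_ac split: split_indicator)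
  qed
  also have "\<dots> = (\<integral>\<^sup>+u\<in>{u. norm u \<ge> 1}. ennreal ((cmod (rescaled \<beta> \<phi> \<eta> \<sigma> u))\<^sup>2 *
      eta_abs \<beta> \<eta> (u::real^'n) powr (- ?d - real_of_ereal (ereal 0) + \<beta>)) \<partial>lborel)"
    by (subst nn_integral_lborel_scaleR[OF _ s(1)]) auto
  also have "\<dots> \<le> ennreal (tail_const C)"
    by (rule mode_scaling_tail[OF ms _ _ \<sigma> \<eta>]) (use \<beta> in auto)
  \<comment> \<open>No sign is prescribed for \<open>tail_const C\<close>, and
    \<open>ennreal\<close> sends negative reals to 0.\<close>
  also have "\<dots> = ennreal (max 0 (tail_const C))" by (simp add: max_def ennreal_neg)
  finally have "ennreal (s powr \<beta>) * (\<integral>\<^sup>+v. ?T v \<partial>lborel) \<le> ennreal (max 0 (tail_const C))" .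
  then have "ennreal (R powr \<beta>) * (ennreal (s powr \<beta>) * (\<integral>\<^sup>+v. ?T v \<partial>lborel)) \<le> ennreal (R powr \<beta>) * ennreal (max 0 (tail_const C))"
    by (rule mult_left_mono) simp
  moreover have "ennreal (R powr \<beta>) * ennreal (s powr \<beta>) = 1"
    using s by (simp add: ennreal_mult'[symmetric] powr_mult[symmetric])
  ultimately show ?thesis by (simp add: mult.assoc[symmetric] ennreal_mult'[symmetric])
qed

text \<open>The radius \<open>R\<close> is chosen so that powers of \<open>R\<close> cancel on both
  sides of the cut. Inside, the squared deviation of the mode from 1 is of order
  \<open>R powr (-\<beta>)\<close> while the \<open>\<beta>\<close>-moment is at most of order
  \<open>R powr \<beta> * F\<close>, which leaves \<open>sqrt F\<close>. Outside, the tail bound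
  \<open>R powr \<beta>\<close> meets the tail of \<open>jap powr (- d - \<beta>)\<close>, of order
  \<open>R powr (-\<beta>)\<close>, which leaves a constant.\<close>

lemma mode_mass_estimate_critical:
  fixes \<sigma> :: "real ^ 'n::finite"
  assumes M: "equilibrium C (ereal 0) \<beta> M" and fm: "fluid_mode C (ereal 0) \<beta> lam M L Dt \<phi> \<mu> \<mu>0"
    and ms: "mode_scaling C (ereal 0) \<beta> M \<phi> \<mu> \<Phi> \<Omega>"
    and \<beta>: "\<beta> > 0" and \<sigma>: "\<sigma> \<in> sphere 0 1"
    and \<eta>: "\<eta> \<in> {0<..<eta0 C}" "\<eta> \<in> {0<..<eta1 C}" "\<eta> < 1"
  defines "R \<equiv> \<eta> powr (- 1 / (1 + \<beta>))" and "c \<equiv> eq_const TYPE('n) 0 \<beta>"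
  defines "F \<equiv> (\<integral>(v::real^'n). jap v powr (- real CARD('n)) * indicator (ball 0 R) v \<partial>lborel)"
  shows "cmod (scal M (\<lambda>_. 1) (\<phi> \<eta> \<sigma>) - of_real (c * F)) \<le>
    \<bar>mode_const C\<bar> * sqrt (theta_upper C * 2 powr \<beta> * c) * sqrt F +
    c * (sqrt (max 0 (tail_const C)) * sqrt (sphere_area TYPE('n) / \<beta>))"
proof -
  let ?d = "real CARD('n)"
  let ?B = "ball 0 R :: (real^'n) set"
  have R: "R > 0" "R \<ge> 1" "\<eta> powr (\<beta> / (1 + \<beta>)) = R powr (- \<beta>)"
    using \<eta> \<beta> powr_mono2'[of "- 1 / (1 + \<beta>)" \<eta> 1] by (auto simp: R_def powr_powr)
  have c: "c \<ge> 0" unfolding c_def by (rule eq_const_nonneg)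
  have Me: "M = (\<lambda>v. c * jap v powr (- ?d))"
    using equilibrium_finite[OF M] unfolding c_def by simp
  have a0: "ereal 0 \<ge> 0" by simp
  note b = fluid_mode_bounds[OF fm \<eta>(1) \<sigma>]
  note Mn = equilibrium_nonneg[OF M a0]
  note Mm [measurable] = equilibrium_measurable[OF M a0]
  have fme [measurable]: "\<phi> \<eta> \<sigma> \<in> borel_measurable borel" using b(1) by (simp add: L2w_def)
  have F0: "F \<ge> 0" unfolding F_def by (intro Bochner_Integration.integral_nonneg) simp
  have Mb: "jap v powr \<beta> * M v * indicator ?B v = c * (jap v powr (\<beta> + - ?d) * indicator ?B v)" for v
    unfolding Me powr_add by (simp only: mult_ac)
  have Mb': "M v * indicator ?B v = c * (jap v powr (- ?d) * indicator ?B v)" for v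
    unfolding Me by (simp only: mult_ac)
  have w: "integrable lborel (\<lambda>v. jap v powr \<beta> * M v * indicator ?B v)"
    unfolding Mb by (intro integrable_mult_right integrable_jap_ball)
  have Mi: "integrable lborel (\<lambda>v. M v * indicator ?B v)"
    unfolding Mb' by (intro integrable_mult_right integrable_jap_ball)
  have MF: "(\<integral>v. M v * indicator ?B v \<partial>lborel) = c * F"
    unfolding Mb' F_def by simp
  note d = L2w_diff_one_bound[OF Mm Mn equilibrium_normalised(1)[OF M] b(1) _ w]
  have inner: "(\<integral>v. cmod (\<phi> \<eta> \<sigma> v - 1) * M v * indicator ?B v \<partial>lborel) \<le>
      \<bar>mode_const C\<bar> * sqrt (theta_upper C * 2 powr \<beta> * c) * sqrt F"
  proof -
    have "(\<integral>v. jap v powr \<beta> * M v * indicator ?B v \<partial>lborel) \<le> (\<integral>v. (2 * R) powr \<beta> * (M v * indicator ?B v) \<partial>lborel)"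
    proof (rule integral_mono[OF w integrable_mult_right[OF Mi]])
      fix v
      have "jap v powr \<beta> \<le> (2 * R) powr \<beta>" if "v \<in> ?B"
        using that R \<beta> jap_pos[of v] by (intro powr_mono2 jap_le) auto
      then show "jap v powr \<beta> * M v * indicator ?B v \<le> (2 * R) powr \<beta> * (M v * indicator ?B v)"
        using Mn[of v] by (auto intro: mult_right_mono split: split_indicator)
    qed
    also have "\<dots> = (2 * R) powr \<beta> * (c * F)" by (simp add: MF)
    finally have W: "(\<integral>v. jap v powr \<beta> * M v * indicator ?B v \<partial>lborel) \<le> (2 * R) powr \<beta> * (c * F)" .
    have "(\<integral>v. cmod (\<phi> \<eta> \<sigma> v - 1) * M v * indicator ?B v \<partial>lborel) \<le>
      normw M (- \<beta>) (\<lambda>v. \<phi> \<eta> \<sigma> v - 1) * sqrt (\<integral>v. jap v powr \<beta> * M v * indicator ?B v \<partial>lborel)"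
      by (rule d(2)) simp
    also have "\<dots> \<le> mode_error C (ereal 0) \<beta> \<eta> * sqrt ((2 * R) powr \<beta> * (c * F))"
    proof (rule mult_mono)
      show "normw M (- \<beta>) (\<lambda>v. \<phi> \<eta> \<sigma> v - 1) \<le> mode_error C (ereal 0) \<beta> \<eta>" by (rule b(4))
      show "sqrt (\<integral>v. jap v powr \<beta> * M v * indicator ?B v \<partial>lborel) \<le> sqrt ((2 * R) powr \<beta> * (c * F))"
        using W by simp
      show "0 \<le> mode_error C (ereal 0) \<beta> \<eta>" using b(2,3) unfolding mode_error_def by (intro mult_nonneg_nonneg) auto
      show "0 \<le> sqrt (\<integral>v. jap v powr \<beta> * M v * indicator ?B v \<partial>lborel)" using Mn by simp
    qed
    \<comment> \<open>For \<open>\<alpha> = 0\<close>, \<open>Theta\<close> is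
      \<open>\<eta> powr (\<beta> / (1 + \<beta>))\<close>, which is exactly
      \<open>R powr (- \<beta>)\<close>.\<close>
    also have "mode_error C (ereal 0) \<beta> \<eta> = \<bar>mode_const C\<bar> * sqrt (theta_upper C * R powr (- \<beta>))"
      using R(3) \<beta> unfolding mode_error_def Theta_def by simp
    also have "sqrt (theta_upper C * R powr (- \<beta>)) * sqrt ((2 * R) powr \<beta> * (c * F)) =
        sqrt (theta_upper C * 2 powr \<beta> * c) * sqrt F"
    proof -
      have "R powr (- \<beta>) * R powr \<beta> = 1" using R(1) by (simp add: powr_add[symmetric])
      then have "theta_upper C * R powr (- \<beta>) * ((2 * R) powr \<beta> * (c * F)) = theta_upper C * 2 powr \<beta> * c * F"
        using R(1) by (simp add: powr_mult mult_ac)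
      then show ?thesis by (simp only: real_sqrt_mult[symmetric])
    qed
    then have "\<bar>mode_const C\<bar> * sqrt (theta_upper C * R powr (- \<beta>)) * sqrt ((2 * R) powr \<beta> * (c * F)) =
      \<bar>mode_const C\<bar> * sqrt (theta_upper C * 2 powr \<beta> * c) * sqrt F" by (simp only: mult.assoc)
    finally show ?thesis .
  qed
  \<comment> \<open>The density \<open>jap powr (- d)\<close> is divided unevenly: \<open>f\<close>
    takes the weight under which the tail of the mode is bounded, and \<open>g\<close> the remaining
    one, which is square integrable because \<open>\<beta> > 0\<close>.\<close>
  define f where "f v = cmod (\<phi> \<eta> \<sigma> v) * jap v powr ((- ?d + \<beta>) / 2) * indicator (- ?B) v" for v
  define g where "g v = jap v powr ((- ?d - \<beta>) / 2) * indicator (- ?B) v" for v :: "real^'n"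
  have [measurable]: "f \<in> borel_measurable borel" "g \<in> borel_measurable borel"
    unfolding f_def g_def by measurable
  have f2: "(f v)\<^sup>2 = (cmod (\<phi> \<eta> \<sigma> v))\<^sup>2 * jap v powr (- ?d + \<beta>) * indicator (- ?B) v" for v
    unfolding f_def power_mult_distrib jap_powr_half_power2 by (simp split: split_indicator)
  have g2: "(g v)\<^sup>2 = jap v powr (- ?d - \<beta>) * indicator (- ?B) v" for v
    unfolding g_def power_mult_distrib jap_powr_half_power2 by (simp split: split_indicator)
  have fg: "cmod (\<phi> \<eta> \<sigma> v) * M v * indicator (- ?B) v = c * (f v * g v)" for v
  proof -
    have "jap v powr (- ?d) = jap v powr ((- ?d + \<beta>) / 2) * jap v powr ((- ?d - \<beta>) / 2)"
      by (simp add: powr_add[symmetric] field_simps)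
    moreover have "indicator (- ?B) v = (indicator (- ?B) v * indicator (- ?B) v :: real)" by (simp split: split_indicator)
    ultimately have "cmod (\<phi> \<eta> \<sigma> v) * M v * indicator (- ?B) v = cmod (\<phi> \<eta> \<sigma> v) *
      (c * (jap v powr ((- ?d + \<beta>) / 2) * jap v powr ((- ?d - \<beta>) / 2))) *
      (indicator (- ?B) v * indicator (- ?B) v)" unfolding Me by simp
    then show ?thesis unfolding f_def g_def by (simp only: mult_ac)
  qed
  have tail: "(\<integral>\<^sup>+v. ennreal ((f v)\<^sup>2) \<partial>lborel) \<le> ennreal (R powr \<beta> * max 0 (tail_const C))"
    unfolding f2 R_def by (rule mode_tail_bound[OF ms \<beta> \<sigma> \<eta>(2) fme])
  have fi: "integrable lborel (\<lambda>v. (f v)\<^sup>2)"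
    using le_less_trans[OF tail ennreal_less_top] by (intro integrableI_bounded) auto
  have fb: "(\<integral>v. (f v)\<^sup>2 \<partial>lborel) \<le> R powr \<beta> * max 0 (tail_const C)"
    by (rule integral_real_bounded[OF _ tail]) simp
  have gi: "integrable lborel (\<lambda>v. (g v)\<^sup>2)"
    unfolding g2 using \<beta> by (intro integrable_real_mult_indicator integrable_jap_powr) auto
  have gb: "(\<integral>v. (g v)\<^sup>2 \<partial>lborel) \<le> sphere_area TYPE('n) / \<beta> * R powr (- \<beta>)"
    unfolding g2 by (rule integral_jap_tail_le[OF \<beta> R(1)])
  note CS = Cauchy_Schwarz_integral[OF _ _ fi gi]
  have fgi: "integrable lborel (\<lambda>v. f v * g v)" by (rule CS(1)) measurable
  have pi: "integrable lborel (\<lambda>v. cmod (\<phi> \<eta> \<sigma> v) * M v * indicator (- ?B) v)"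
    unfolding fg using fgi by (rule integrable_mult_right)
  have outer: "(\<integral>v. cmod (\<phi> \<eta> \<sigma> v) * M v * indicator (- ?B) v \<partial>lborel) \<le>
      c * (sqrt (max 0 (tail_const C)) * sqrt (sphere_area TYPE('n) / \<beta>))"
  proof -
    have "(\<integral>v. f v * g v \<partial>lborel) \<le> (\<integral>v. \<bar>f v * g v\<bar> \<partial>lborel)"
      using fgi by (intro integral_mono) auto
    also have "\<dots> \<le> sqrt (\<integral>v. (f v)\<^sup>2 \<partial>lborel) * sqrt (\<integral>v. (g v)\<^sup>2 \<partial>lborel)" by (rule CS(2)) measurable
    also have "\<dots> \<le> sqrt (R powr \<beta> * max 0 (tail_const C)) * sqrt (sphere_area TYPE('n) / \<beta> * R powr (- \<beta>))"
      using fb gb by (intro mult_mono) auto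
    also have "\<dots> = sqrt (max 0 (tail_const C)) * sqrt (sphere_area TYPE('n) / \<beta>)"
    proof -
      have "R powr \<beta> * R powr (- \<beta>) = 1" using R(1) by (simp add: powr_add[symmetric])
      then have "(R powr \<beta> * R powr (- \<beta>)) * (max 0 (tail_const C) * (sphere_area TYPE('n) / \<beta>)) =
        max 0 (tail_const C) * (sphere_area TYPE('n) / \<beta>)" by simp
      then have "R powr \<beta> * max 0 (tail_const C) * (sphere_area TYPE('n) / \<beta> * R powr (- \<beta>)) =
        max 0 (tail_const C) * (sphere_area TYPE('n) / \<beta>)" by (simp only: mult_ac)
      then show ?thesis by (simp only: real_sqrt_mult[symmetric])
    qed
    finally show ?thesis unfolding fg using c by (simp add: mult_left_mono)
  qed
  have "cmod (scal M (\<lambda>_. 1) (\<phi> \<eta> \<sigma>) - of_real (\<integral>v. M v * indicator ?B v \<partial>lborel)) \<le>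
      (\<integral>v. cmod (\<phi> \<eta> \<sigma> v - 1) * M v * indicator ?B v \<partial>lborel) + (\<integral>v. cmod (\<phi> \<eta> \<sigma> v) * M v * indicator (- ?B) v \<partial>lborel)"
    by (rule scal_one_approx[OF Mm fme _ Mn d(1) Mi pi]) auto
  with inner outer show ?thesis unfolding MF by linarith
qed

text \<open>Since \<open>ln R = \<bar>ln \<eta>\<bar> / (1 + \<beta>)\<close>, the integral
  \<open>F\<close> over the ball is \<open>P * \<bar>ln \<eta>\<bar>\<close> up to the bounded error
  \<open>K\<close>. Both error terms of the estimate, of order \<open>sqrt F\<close> and 1,
  disappear after division by \<open>\<bar>ln \<eta>\<bar>\<close>.\<close>

lemma mode_mass_limit_critical:
  fixes \<sigma> :: "real ^ 'n::finite"
  assumes \<beta>: "\<beta> > 0" and \<sigma>: "\<sigma> \<in> sphere 0 1"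
  shows "uniform_limit (admissible C (ereal 0) \<beta> lam) (\<lambda>\<eta> x. mode_mass \<sigma> \<eta> x / of_real \<bar>ln \<eta>\<bar>)
    (\<lambda>_. of_real (eq_const TYPE('n) 0 \<beta> * sphere_area TYPE('n) / (1 + \<beta>))) (at_right 0)"
proof (rule uniform_limitI, rule eventually_admissible)
  fix e :: real assume "e > 0" and ne: "admissible C (ereal 0) \<beta> lam \<noteq> {}"
  define c where "c = eq_const TYPE('n) 0 \<beta>"
  define S where "S = sphere_area TYPE('n)"
  define P where "P = S / (1 + \<beta>)"
  define A where "A = \<bar>mode_const C\<bar> * sqrt (theta_upper C * 2 powr \<beta> * c)"
  define A' where "A' = c * (sqrt (max 0 (tail_const C)) * sqrt (S / \<beta>))"
  have c: "c \<ge> 0" unfolding c_def by (rule eq_const_nonneg)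
  have P: "P > 0" unfolding P_def S_def using \<beta> sphere_area_pos[where 'n='n] by simp
  from ne obtain M \<phi> \<mu> \<mu>0 L Dt \<Phi> \<Omega> where fm0: "fluid_mode C (ereal 0) \<beta> lam M L Dt \<phi> \<mu> \<mu>0"
    and ms0: "mode_scaling C (ereal 0) \<beta> M \<phi> \<mu> \<Phi> \<Omega>"
    unfolding admissible_def by blast
  have eta1: "eta1 C > 0" by (rule mode_scaling_growth(1)[OF ms0]) (use \<beta> in simp)
  have A: "A \<ge> 0"
  proof -
    have "theta_upper C > 0" using fm0 unfolding fluid_mode_def by linarith
    then show ?thesis using c by (simp add: A_def)
  qed
  obtain K where K: "\<And>R. R \<ge> 1 \<Longrightarrow>
      \<bar>(\<integral>(v::real^'n). jap v powr (- real CARD('n)) * indicator (ball 0 R) v \<partial>lborel) - S * ln R\<bar> \<le> K"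
    using integral_jap_ball_log[where 'n='n] unfolding S_def by blast
  have lim: "((\<lambda>l. (A * sqrt (P * l + K) + (A' + c * K)) / l) \<longlongrightarrow> 0) at_top"
  proof -
    have "((\<lambda>l. sqrt (P * l + K) / l) \<longlongrightarrow> 0) at_top" using P by real_asymp
    moreover have "((\<lambda>l::real. 1 / l) \<longlongrightarrow> 0) at_top" by real_asymp
    ultimately have "((\<lambda>l. A * (sqrt (P * l + K) / l) + (A' + c * K) * (1 / l)) \<longlongrightarrow> A * 0 + (A' + c * K) * 0) at_top"
      by (intro tendsto_add tendsto_mult tendsto_const)
    then show ?thesis by (simp add: add_divide_distrib)
  qed
  have "filterlim (\<lambda>\<eta>::real. \<bar>ln \<eta>\<bar>) at_top (at_right 0)" by real_asymp
  from filterlim_compose[OF lim this]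
  have "eventually (\<lambda>\<eta>. (A * sqrt (P * \<bar>ln \<eta>\<bar> + K) + (A' + c * K)) / \<bar>ln \<eta>\<bar> < e) (at_right 0)"
    using \<open>e > 0\<close> by (rule order_tendstoD(2))
  moreover have "eventually (\<lambda>\<eta>. \<eta> \<in> {0<..<min (eta1 C) 1}) (at_right 0)"
    using eta1 by (intro eventually_at_right_real) auto
  ultimately
  show "eventually (\<lambda>\<eta>. \<eta> \<in> {0<..<eta0 C} \<longrightarrow> (\<forall>x\<in>admissible C (ereal 0) \<beta> lam.
      dist (mode_mass \<sigma> \<eta> x / of_real \<bar>ln \<eta>\<bar>) (of_real (eq_const TYPE('n) 0 \<beta> * sphere_area TYPE('n) / (1 + \<beta>))) < e)) (at_right 0)"
  proof (eventually_elim, intro impI ballI)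
    fix \<eta> x
    assume small: "(A * sqrt (P * \<bar>ln \<eta>\<bar> + K) + (A' + c * K)) / \<bar>ln \<eta>\<bar> < e"
      and \<eta>1: "\<eta> \<in> {0<..<min (eta1 C) 1}"
      and \<eta>: "\<eta> \<in> {0<..<eta0 C}" and x: "x \<in> admissible C (ereal 0) \<beta> lam"
    obtain M \<phi> \<mu> \<mu>0 where xe: "x = (M, \<phi>, \<mu>, \<mu>0)" by (cases x)
    obtain L Dt \<Phi> \<Omega> where M: "equilibrium C (ereal 0) \<beta> M" and fm: "fluid_mode C (ereal 0) \<beta> lam M L Dt \<phi> \<mu> \<mu>0"
      and ms: "mode_scaling C (ereal 0) \<beta> M \<phi> \<mu> \<Phi> \<Omega>"
      using x unfolding xe by (rule admissible_D)
    define l where "l = \<bar>ln \<eta>\<bar>"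
    define R where "R = \<eta> powr (- 1 / (1 + \<beta>))"
    define F where "F = (\<integral>(v::real^'n). jap v powr (- real CARD('n)) * indicator (ball 0 R) v \<partial>lborel)"
    have l: "l > 0" "l = - ln \<eta>" using \<eta>1 by (auto simp: l_def)
    have lnR: "S * ln R = P * l"
      using \<eta>1 unfolding l(2) R_def P_def by (simp add: ln_powr)
    have "R \<ge> 1" using \<eta>1 \<beta> powr_mono2'[of "- 1 / (1 + \<beta>)" \<eta> 1] by (simp add: R_def)
    from K[OF this] have F: "\<bar>F - P * l\<bar> \<le> K" unfolding F_def lnR .
    have 1: "cmod (scal M (\<lambda>_. 1) (\<phi> \<eta> \<sigma>) - of_real (c * F)) \<le> A * sqrt F + A'"
      unfolding A_def A'_def S_def c_def F_def R_def
      by (rule mode_mass_estimate_critical[OF M fm ms \<beta> \<sigma> \<eta>]) (use \<eta>1 in auto)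
    have 2: "cmod (complex_of_real (c * F) - of_real (c * (P * l))) \<le> c * K"
    proof -
      have "cmod (complex_of_real (c * F) - of_real (c * (P * l))) = c * \<bar>F - P * l\<bar>"
        unfolding of_real_diff[symmetric] norm_of_real right_diff_distrib[symmetric] abs_mult using c by simp
      then show ?thesis using F c by (simp add: mult_left_mono)
    qed
    have "A * sqrt F \<le> A * sqrt (P * l + K)" using A F by (intro mult_left_mono) auto
    with norm_diff_triangle_le[OF 1 2]
    have 3: "cmod (scal M (\<lambda>_. 1) (\<phi> \<eta> \<sigma>) - of_real (c * (P * l))) \<le> A * sqrt (P * l + K) + (A' + c * K)"
      by linarith
    have "mode_mass \<sigma> \<eta> x / of_real l - of_real (c * P) = (scal M (\<lambda>_. 1) (\<phi> \<eta> \<sigma>) - of_real (c * (P * l))) / of_real l"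
      using l(1) by (simp add: xe mode_mass_def field_simps)
    then have "cmod (mode_mass \<sigma> \<eta> x / of_real l - of_real (c * P)) =
      cmod (scal M (\<lambda>_. 1) (\<phi> \<eta> \<sigma>) - of_real (c * (P * l))) / l"
      using l(1) by (simp only: norm_divide norm_of_real)
    also have "\<dots> \<le> (A * sqrt (P * l + K) + (A' + c * K)) / l"
      using 3 l(1) by (intro divide_right_mono) auto
    also have "\<dots> < e" using small unfolding l_def .
    finally show "dist (mode_mass \<sigma> \<eta> x / of_real \<bar>ln \<eta>\<bar>)
        (of_real (eq_const TYPE('n) 0 \<beta> * sphere_area TYPE('n) / (1 + \<beta>))) < e"
      unfolding l_def[symmetric] dist_norm c_def P_def S_def by (simp only: times_divide_eq_right)
  qed
qed

section \<open>The diffusion coefficient\<close>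

text \<open>The order of growth of the mode's mass. For \<open>\<alpha> = 0\<close> its logarithm
  compensates the one in the denominator of \<open>theta\<close>.\<close>

definition log_factor :: "ereal \<Rightarrow> real \<Rightarrow> real" where
  "log_factor \<alpha> \<eta> = (if \<alpha> = 0 then \<bar>ln \<eta>\<bar> else 1)"

section \<open>Comparison of the scales and uniform limits of the factors\<close>

text \<open>Here \<open>x\<close> stands for the norm of the frequency. The power parts are
  homogeneous of degree \<open>zeta\<close> and cancel exactly; in the two borderline cases there
  remains a quotient of \<open>ln \<epsilon>\<close> and \<open>ln (\<epsilon> * x)\<close>, which
  tends to 1.\<close>

lemma scaling_ratio_tendsto:
  assumes \<alpha>: "\<alpha> + ereal \<beta> > 0" "\<alpha> \<ge> 0" and x: "x > 0"
  shows "((\<lambda>\<epsilon>. Theta \<alpha> \<beta> (\<epsilon> * x) * x powr (- zeta \<alpha> \<beta>) / (theta \<alpha> \<beta> \<epsilon> * log_factor \<alpha> (\<epsilon> * x))) \<longlongrightarrow> 1) (at_right 0)"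
proof -
  have pos: "eventually (\<lambda>\<epsilon>::real. \<epsilon> > 0) (at_right 0)" by (simp add: eventually_at_right_less)
  have ln1: "((\<lambda>\<epsilon>. \<bar>ln (\<epsilon> * x)\<bar> / \<bar>ln \<epsilon>\<bar>) \<longlongrightarrow> 1) (at_right 0)" using x by real_asymp
  have ln2: "((\<lambda>\<epsilon>. \<bar>ln \<epsilon>\<bar> / \<bar>ln (\<epsilon> * x)\<bar>) \<longlongrightarrow> 1) (at_right 0)" using x by real_asymp
  have sq: "(\<epsilon> * x)\<^sup>2 * x powr - 2 = \<epsilon>\<^sup>2" for \<epsilon>
    using x by (simp add: powr_minus powr_numeral power_mult_distrib)
  have pw: "(\<epsilon> * x) powr p * x powr (- p) = \<epsilon> powr p" if "\<epsilon> > 0" for \<epsilon> p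
    using x that by (simp add: powr_mult powr_minus)
  consider "\<alpha> > ereal (2 + \<beta>)" | "\<alpha> = ereal (2 + \<beta>)" | a where "\<alpha> = ereal a" "a < 2 + \<beta>" "a \<noteq> 0"
    | "\<alpha> = 0" "0 < 2 + \<beta>"
  proof (cases \<alpha>)
    case (real r)
    then consider "r > 2 + \<beta>" | "r = 2 + \<beta>" | "r < 2 + \<beta>" "r \<noteq> 0" | "r < 2 + \<beta>" "r = 0" by linarith
    then show ?thesis by cases (use real that in \<open>auto simp: zero_ereal_def\<close>)
  qed (use \<alpha> that in auto)
  then show ?thesis
  proof cases
    case 1
    \<comment> \<open>If \<open>\<alpha>\<close> were 0, then \<open>\<beta> > 0\<close> and
      \<open>\<alpha>\<close> would lie below \<open>2 + \<beta>\<close>.\<close>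
    have "\<alpha> \<noteq> 0" using 1 \<alpha> by (auto simp: zero_ereal_def)
    have "eventually (\<lambda>\<epsilon>. 1 = Theta \<alpha> \<beta> (\<epsilon> * x) * x powr (- zeta \<alpha> \<beta>) / (theta \<alpha> \<beta> \<epsilon> * log_factor \<alpha> (\<epsilon> * x))) (at_right 0)"
      using pos by eventually_elim
        (use 1 \<open>\<alpha> \<noteq> 0\<close> sq in \<open>auto simp: Theta_def zeta_def theta_def log_factor_def powr_numeral\<close>)
    then show ?thesis by (rule Lim_transform_eventually[OF tendsto_const])
  next
    case 2
    have "\<alpha> \<noteq> 0" using 2 \<alpha> by (auto simp: zero_ereal_def)
    have "eventually (\<lambda>\<epsilon>. \<bar>ln (\<epsilon> * x)\<bar> / \<bar>ln \<epsilon>\<bar> = Theta \<alpha> \<beta> (\<epsilon> * x) * x powr (- zeta \<alpha> \<beta>) / (theta \<alpha> \<beta> \<epsilon> * log_factor \<alpha> (\<epsilon> * x))) (at_right 0)"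
      using pos
    proof eventually_elim
      case (elim \<epsilon>)
      have "Theta \<alpha> \<beta> (\<epsilon> * x) * x powr (- zeta \<alpha> \<beta>) = (\<epsilon> * x)\<^sup>2 * x powr - 2 * \<bar>ln (\<epsilon> * x)\<bar>"
        using 2 by (simp add: Theta_def zeta_def)
      also have "\<dots> = \<epsilon>\<^sup>2 * \<bar>ln (\<epsilon> * x)\<bar>" by (simp only: sq)
      finally have "Theta \<alpha> \<beta> (\<epsilon> * x) * x powr (- zeta \<alpha> \<beta>) = \<epsilon>\<^sup>2 * \<bar>ln (\<epsilon> * x)\<bar>" .
      then show ?case using 2 \<open>\<alpha> \<noteq> 0\<close> elim by (simp add: theta_def log_factor_def)
    qed
    then show ?thesis by (rule Lim_transform_eventually[OF ln1])
  next
    case 3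
    have "eventually (\<lambda>\<epsilon>. 1 = Theta \<alpha> \<beta> (\<epsilon> * x) * x powr (- zeta \<alpha> \<beta>) / (theta \<alpha> \<beta> \<epsilon> * log_factor \<alpha> (\<epsilon> * x))) (at_right 0)"
      using pos by eventually_elim
        (use 3 pw in \<open>simp add: Theta_def zeta_def theta_def log_factor_def zero_ereal_def\<close>)
    then show ?thesis by (rule Lim_transform_eventually[OF tendsto_const])
  next
    case 4
    have "eventually (\<lambda>\<epsilon>. \<bar>ln \<epsilon>\<bar> / \<bar>ln (\<epsilon> * x)\<bar> = Theta \<alpha> \<beta> (\<epsilon> * x) * x powr (- zeta \<alpha> \<beta>) / (theta \<alpha> \<beta> \<epsilon> * log_factor \<alpha> (\<epsilon> * x))) (at_right 0)"
      using pos by eventually_elim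
        (use 4 pw in \<open>simp add: Theta_def zeta_def theta_def log_factor_def zero_ereal_def\<close>)
    then show ?thesis by (rule Lim_transform_eventually[OF ln2])
  qed
qed

lemma mu_ratio_limit:
  "uniform_limit (admissible C \<alpha> \<beta> lam) (\<lambda>\<eta> (M, \<phi>, \<mu>, \<mu>0). complex_of_real (\<mu> \<eta> / Theta \<alpha> \<beta> \<eta>))
    (\<lambda>(M, \<phi>, \<mu>, \<mu>0). of_real \<mu>0) (at_right 0)"
proof (rule uniform_limitI, rule eventually_admissible)
  fix e :: real assume "e > 0" and ne: "admissible C \<alpha> \<beta> lam \<noteq> {}"
  from ne obtain M \<phi> \<mu> \<mu>0 L Dt where fm0: "fluid_mode C \<alpha> \<beta> lam M L Dt \<phi> \<mu> \<mu>0"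
    unfolding admissible_def by blast
  have "(mu_rate C \<longlongrightarrow> 0) (at_right 0)" using fm0 unfolding fluid_mode_def by blast
  then have "eventually (\<lambda>\<eta>. mu_rate C \<eta> < e) (at_right 0)" using \<open>e > 0\<close> by (rule order_tendstoD(2))
  then show "eventually (\<lambda>\<eta>. \<eta> \<in> {0<..<eta0 C} \<longrightarrow> (\<forall>x\<in>admissible C \<alpha> \<beta> lam.
      dist (case x of (M, \<phi>, \<mu>, \<mu>0) \<Rightarrow> complex_of_real (\<mu> \<eta> / Theta \<alpha> \<beta> \<eta>)) (case x of (M, \<phi>, \<mu>, \<mu>0) \<Rightarrow> of_real \<mu>0) < e)) (at_right 0)"
  proof (eventually_elim, intro impI ballI)
    fix \<eta> x
    assume small: "mu_rate C \<eta> < e" and \<eta>: "\<eta> \<in> {0<..<eta0 C}" and x: "x \<in> admissible C \<alpha> \<beta> lam"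
    obtain M \<phi> \<mu> \<mu>0 where xe: "x = (M, \<phi>, \<mu>, \<mu>0)" by (cases x)
    obtain L Dt where fm: "fluid_mode C \<alpha> \<beta> lam M L Dt \<phi> \<mu> \<mu>0"
      using x unfolding xe by (rule admissible_D)
    then have "\<bar>\<mu> \<eta> / Theta \<alpha> \<beta> \<eta> - \<mu>0\<bar> \<le> mu_rate C \<eta>" using \<eta> unfolding fluid_mode_def by blast
    then show "dist (case x of (M, \<phi>, \<mu>, \<mu>0) \<Rightarrow> complex_of_real (\<mu> \<eta> / Theta \<alpha> \<beta> \<eta>)) (case x of (M, \<phi>, \<mu>, \<mu>0) \<Rightarrow> of_real \<mu>0) < e"
      using small unfolding xe prod.case dist_of_real dist_real_def by linarith
  qed
qed

definition limit_mass ::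
  "ereal \<Rightarrow> real \<Rightarrow> (real ^ 'n::finite \<Rightarrow> real) \<times> (real \<Rightarrow> real ^ 'n \<Rightarrow> real ^ 'n \<Rightarrow> complex) \<times> (real \<Rightarrow> real) \<times> real \<Rightarrow> real" where
  "limit_mass \<alpha> \<beta> = (\<lambda>(M, _). if \<alpha> > 0 then \<integral>v. M v \<partial>lborel else eq_const TYPE('n) 0 \<beta> * sphere_area TYPE('n) / (1 + \<beta>))"

lemma mode_mass_limit:
  fixes \<sigma> :: "real ^ 'n::finite"
  assumes \<alpha>: "\<alpha> + ereal \<beta> > 0" "\<alpha> \<ge> 0" and \<sigma>: "\<sigma> \<in> sphere 0 1"
  shows "uniform_limit (admissible C \<alpha> \<beta> lam) (\<lambda>\<eta> x. mode_mass \<sigma> \<eta> x / of_real (log_factor \<alpha> \<eta>))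
    (\<lambda>x. of_real (limit_mass \<alpha> \<beta> x)) (at_right 0)"
proof (cases "\<alpha> = 0")
  case True
  then have "\<beta> > 0" using \<alpha> by simp
  from mode_mass_limit_critical[OF this \<sigma>, of C lam] True
  show ?thesis unfolding log_factor_def limit_mass_def by (simp add: zero_ereal_def case_prod_unfold)
next
  case False
  then have pos: "\<alpha> > 0" using \<alpha> by simp
  have "uniform_limit (admissible C \<alpha> \<beta> lam) (mode_mass \<sigma>) (\<lambda>(M, _). of_real (\<integral>v. M v \<partial>lborel)) (at_right 0)"
  proof (cases "ereal \<beta> < \<alpha>")
    case True
    then show ?thesis by (rule mode_mass_limit_light[OF \<alpha>(1) pos \<sigma>])
  next
    case False
    then obtain a where "\<alpha> = ereal a" "a > 0" "a \<le> \<beta>" using pos by (cases \<alpha>) auto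
    then show ?thesis using mode_mass_limit_heavy[OF _ _ \<sigma>] by blast
  qed
  then show ?thesis using pos False unfolding log_factor_def limit_mass_def by (simp add: case_prod_unfold)
qed

text \<open>Division of uniform limits requires the limit of the denominator to stay away from 0
  uniformly over the data.\<close>

lemma limit_mass_lower_bound:
  fixes C :: "'n::finite hyp_consts"
  assumes \<alpha>: "\<alpha> + ereal \<beta> > 0" "\<alpha> \<ge> 0"
  obtains m where "m > 0" "\<And>x. x \<in> admissible C \<alpha> \<beta> lam \<Longrightarrow> m \<le> limit_mass \<alpha> \<beta> x"
proof (cases "\<alpha> > 0")
  case True
  obtain m where m: "m > 0" "\<And>M. equilibrium C \<alpha> \<beta> M \<Longrightarrow> m \<le> (\<integral>(v::real^'n). M v \<partial>lborel)"
    using equilibrium_mass_lower_bound[OF \<alpha>(1) True, of C] by blast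
  show ?thesis
    by (rule that[OF m(1)]) (use m(2) True in \<open>auto simp: admissible_def limit_mass_def\<close>)
next
  case False
  then have a: "\<alpha> = ereal 0" "\<beta> > 0" using \<alpha> by (auto simp: zero_ereal_def)
  let ?m = "eq_const TYPE('n) 0 \<beta> * sphere_area TYPE('n) / (1 + \<beta>)"
  show ?thesis
  \<comment> \<open>Positivity of \<open>?m\<close> is available only once some equilibrium exists;
    the value 1 serves when there is none.\<close>
  proof (rule that[of "if ?m > 0 then ?m else 1"])
    fix x assume x: "x \<in> admissible C \<alpha> \<beta> lam"
    then obtain M where "equilibrium C (ereal 0) \<beta> M" unfolding admissible_def a by blast
    from eq_const_pos[OF this] have "?m > 0" using a sphere_area_pos[where 'n='n] by simp
    then show "(if ?m > 0 then ?m else 1) \<le> limit_mass \<alpha> \<beta> x"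
      using False by (simp add: limit_mass_def case_prod_unfold)
  qed simp
qed

section \<open>From uniform convergence to a common rate\<close>

text \<open>The rate is the supremum of the distances over \<open>X\<close>. It is meaningful for
  small \<open>\<epsilon>\<close>, where uniform convergence bounds all distances by 1. The empty
  set is treated apart because a real supremum over it carries no information.\<close>

lemma uniform_limit_rate:
  fixes f :: "real \<Rightarrow> 'a \<Rightarrow> 'b::metric_space"
  assumes "uniform_limit X f l (at_right 0)"
  shows "\<exists>\<omega> \<epsilon>0. (\<omega> \<longlongrightarrow> (0::real)) (at_right 0) \<and> \<epsilon>0 > 0 \<and> (\<forall>\<epsilon>\<in>{0<..<\<epsilon>0}. \<forall>x\<in>X. dist (f \<epsilon> x) (l x) \<le> \<omega> \<epsilon>)"
proof (cases "X = {}")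
  case True
  then show ?thesis by (intro exI[of _ "\<lambda>_. 0"] exI[of _ 1]) auto
next
  case False
  define \<omega> where "\<omega> \<epsilon> = (SUP x\<in>X. dist (f \<epsilon> x) (l x))" for \<epsilon>
  have "eventually (\<lambda>\<epsilon>. \<forall>x\<in>X. dist (f \<epsilon> x) (l x) < 1) (at_right 0)"
    by (rule uniform_limitD[OF assms]) simp
  then obtain \<epsilon>0 where \<epsilon>0: "\<epsilon>0 > 0" "\<And>\<epsilon> x. 0 < \<epsilon> \<Longrightarrow> \<epsilon> < \<epsilon>0 \<Longrightarrow> x \<in> X \<Longrightarrow> dist (f \<epsilon> x) (l x) < 1"
    unfolding eventually_at_right_field by blast
  have le: "dist (f \<epsilon> x) (l x) \<le> \<omega> \<epsilon>" if "0 < \<epsilon>" "\<epsilon> < \<epsilon>0" "x \<in> X" for \<epsilon> x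
    unfolding \<omega>_def using \<epsilon>0(2)[OF that(1,2)] that(3)
    by (intro cSUP_upper bdd_aboveI2[where M=1]) (auto intro: less_imp_le)
  have "(\<omega> \<longlongrightarrow> 0) (at_right 0)"
  proof (rule tendstoI)
    fix e :: real assume "e > 0"
    \<comment> \<open>Strictness is lost in the supremum, so \<open>e / 2\<close> is used to end
      below \<open>e\<close>.\<close>
    have "eventually (\<lambda>\<epsilon>. \<forall>x\<in>X. dist (f \<epsilon> x) (l x) < e / 2) (at_right 0)"
      by (rule uniform_limitD[OF assms]) (use \<open>e > 0\<close> in simp)
    moreover have "eventually (\<lambda>\<epsilon>. \<epsilon> \<in> {0<..<\<epsilon>0}) (at_right 0)"
      using \<epsilon>0(1) by (rule eventually_at_right_real)
    ultimately show "eventually (\<lambda>\<epsilon>. dist (\<omega> \<epsilon>) 0 < e) (at_right 0)"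
    proof eventually_elim
      case (elim \<epsilon>)
      have "\<omega> \<epsilon> \<le> e / 2" unfolding \<omega>_def using False elim(1) by (intro cSUP_least) (auto intro: less_imp_le)
      moreover obtain x where "x \<in> X" using False by blast
      then have "dist (f \<epsilon> x) (l x) \<le> \<omega> \<epsilon>" using elim(2) by (intro le) auto
      then have "0 \<le> \<omega> \<epsilon>" using zero_le_dist[of "f \<epsilon> x" "l x"] by linarith
      ultimately show ?case using \<open>e > 0\<close> by simp
    qed
  qed
  then show ?thesis using \<epsilon>0(1) le by (intro exI[of _ \<omega>] exI[of _ \<epsilon>0]) auto
qed

section \<open>Limit of the diffusion quotient\<close>

text \<open>The quotient equals \<open>\<mu> / Theta\<close> times the scale ratio \<open>r\<close>,
  divided by the normalised mass of the mode. Each factor converges uniformly over the data; the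
  limits in the numerator are bounded by \<open>theta_upper C\<close>, and those in the denominator
  are bounded below.\<close>

lemma diffusion_quotient_limit:
  fixes \<xi> :: "real ^ 'n::finite"
  assumes \<alpha>: "\<alpha> + ereal \<beta> > 0" "\<alpha> \<ge> 0" and \<xi>: "\<xi> \<noteq> 0"
  shows "uniform_limit (admissible C \<alpha> \<beta> lam) (\<lambda>\<epsilon> (M, \<phi>, \<mu>, \<mu>0). diffusion_quotient \<alpha> \<beta> M \<phi> \<mu> \<xi> \<epsilon>)
    (\<lambda>(M, \<phi>, \<mu>, \<mu>0). of_real (kappa \<alpha> \<beta> M \<mu>0)) (at_right 0)"
proof -
  let ?X = "admissible C \<alpha> \<beta> lam"
  define x where "x = norm \<xi>"
  have x: "x > 0" using \<xi> by (simp add: x_def)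
  have \<sigma>: "sgn \<xi> \<in> sphere 0 1" using \<xi> by (simp add: norm_sgn)
  have comp: "filterlim (\<lambda>\<epsilon>. \<epsilon> * x) (at_right 0) (at_right 0)" using x by real_asymp
  define r where "r \<epsilon> = Theta \<alpha> \<beta> (\<epsilon> * x) * x powr (- zeta \<alpha> \<beta>) / (theta \<alpha> \<beta> \<epsilon> * log_factor \<alpha> (\<epsilon> * x))" for \<epsilon>
  have r: "(r \<longlongrightarrow> 1) (at_right 0)" unfolding r_def[abs_def] by (rule scaling_ratio_tendsto[OF \<alpha> x])
  have ulr: "uniform_limit ?X (\<lambda>\<epsilon> _. complex_of_real (r \<epsilon>)) (\<lambda>_. 1) (at_right 0)"
    using tendsto_of_real[OF r, where 'a=complex]
    by (intro uniform_limitI) (auto simp: tendsto_iff elim!: eventually_mono)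
  have bdd: "bounded ((\<lambda>(M, \<phi>, \<mu>, \<mu>0). complex_of_real \<mu>0) ` ?X)"
    unfolding bounded_iff
  proof (intro exI[of _ "\<bar>theta_upper C\<bar>"] ballI)
    fix z assume "z \<in> (\<lambda>(M, \<phi>, \<mu>, \<mu>0). complex_of_real \<mu>0) ` ?X"
    then obtain M \<phi> \<mu> \<mu>0 L Dt where "z = complex_of_real \<mu>0" "fluid_mode C \<alpha> \<beta> lam M L Dt \<phi> \<mu> \<mu>0"
      unfolding admissible_def by auto
    then show "cmod z \<le> \<bar>theta_upper C\<bar>" unfolding fluid_mode_def by auto
  qed
  have "uniform_limit ?X (\<lambda>\<epsilon> y. (case y of (M, \<phi>, \<mu>, \<mu>0) \<Rightarrow> complex_of_real (\<mu> (\<epsilon> * x) / Theta \<alpha> \<beta> (\<epsilon> * x))) * of_real (r \<epsilon>))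
    (\<lambda>y. (case y of (M, \<phi>, \<mu>, \<mu>0) \<Rightarrow> of_real \<mu>0) * 1) (at_right 0)"
    by (rule uniform_lim_mult[OF filterlim_compose[OF mu_ratio_limit comp] ulr bdd]) (auto simp: bounded_iff)
  then have num: "uniform_limit ?X (\<lambda>\<epsilon> y. (case y of (M, \<phi>, \<mu>, \<mu>0) \<Rightarrow> complex_of_real (\<mu> (\<epsilon> * x) / Theta \<alpha> \<beta> (\<epsilon> * x))) * of_real (r \<epsilon>))
    (\<lambda>(M, \<phi>, \<mu>, \<mu>0). of_real \<mu>0) (at_right 0)" by simp
  obtain m where m: "m > 0" "\<And>y. y \<in> ?X \<Longrightarrow> m \<le> limit_mass \<alpha> \<beta> y"
    using limit_mass_lower_bound[OF \<alpha>, of C lam] by blast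
  have "uniform_limit ?X (\<lambda>\<epsilon> y. (case y of (M, \<phi>, \<mu>, \<mu>0) \<Rightarrow> complex_of_real (\<mu> (\<epsilon> * x) / Theta \<alpha> \<beta> (\<epsilon> * x))) * of_real (r \<epsilon>)
      / (mode_mass (sgn \<xi>) (\<epsilon> * x) y / of_real (log_factor \<alpha> (\<epsilon> * x))))
    (\<lambda>y. (case y of (M, \<phi>, \<mu>, \<mu>0) \<Rightarrow> of_real \<mu>0) / of_real (limit_mass \<alpha> \<beta> y)) (at_right 0)"
  proof (rule uniform_lim_divide[OF num filterlim_compose[OF mode_mass_limit[OF \<alpha> \<sigma>] comp] bdd])
    show "m \<le> cmod (of_real (limit_mass \<alpha> \<beta> y))" if "y \<in> ?X" for y
      using m(2)[OF that] unfolding norm_of_real by linarith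
  qed (rule m(1))
  moreover have "eventually (\<lambda>\<epsilon>. \<forall>y\<in>?X. (case y of (M, \<phi>, \<mu>, \<mu>0) \<Rightarrow> complex_of_real (\<mu> (\<epsilon> * x) / Theta \<alpha> \<beta> (\<epsilon> * x))) * of_real (r \<epsilon>)
      / (mode_mass (sgn \<xi>) (\<epsilon> * x) y / of_real (log_factor \<alpha> (\<epsilon> * x)))
      = (case y of (M, \<phi>, \<mu>, \<mu>0) \<Rightarrow> diffusion_quotient \<alpha> \<beta> M \<phi> \<mu> \<xi> \<epsilon>)) (at_right 0)"
  proof -
    \<comment> \<open>For \<open>\<epsilon> * x < 1\<close> the logarithm of
      \<open>\<epsilon> * x\<close> is nonzero, so that \<open>Theta\<close> and
      \<open>log_factor\<close> may be cancelled.\<close>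
    have "eventually (\<lambda>\<epsilon>. \<epsilon> \<in> {0<..<1 / x}) (at_right 0)" using x by (intro eventually_at_right_real) simp
    then show ?thesis
    proof (eventually_elim, intro ballI)
      fix \<epsilon> y assume \<epsilon>: "\<epsilon> \<in> {0<..<1 / x}" and "y \<in> ?X"
      then have \<eta>: "0 < \<epsilon> * x" "\<epsilon> * x < 1" using x by (auto simp: field_simps)
      have nz: "Theta \<alpha> \<beta> (\<epsilon> * x) \<noteq> 0" "log_factor \<alpha> (\<epsilon> * x) \<noteq> 0"
        using \<eta> unfolding Theta_def log_factor_def by auto
      obtain M \<phi> \<mu> \<mu>0 where y: "y = (M, \<phi>, \<mu>, \<mu>0)" by (cases y)
      have "\<mu> (\<epsilon> * x) / Theta \<alpha> \<beta> (\<epsilon> * x) * r \<epsilon> * log_factor \<alpha> (\<epsilon> * x) = \<mu> (\<epsilon> * x) * x powr (- zeta \<alpha> \<beta>) / theta \<alpha> \<beta> \<epsilon>"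
        unfolding r_def using nz by simp
      then have "complex_of_real (\<mu> (\<epsilon> * x) / Theta \<alpha> \<beta> (\<epsilon> * x)) * of_real (r \<epsilon>) * of_real (log_factor \<alpha> (\<epsilon> * x)) =
          of_real (\<mu> (\<epsilon> * x) * x powr (- zeta \<alpha> \<beta>)) / of_real (theta \<alpha> \<beta> \<epsilon>)"
        by (simp only: of_real_mult[symmetric] of_real_divide[symmetric])
      then show "(case y of (M, \<phi>, \<mu>, \<mu>0) \<Rightarrow> complex_of_real (\<mu> (\<epsilon> * x) / Theta \<alpha> \<beta> (\<epsilon> * x))) * of_real (r \<epsilon>)
          / (mode_mass (sgn \<xi>) (\<epsilon> * x) y / of_real (log_factor \<alpha> (\<epsilon> * x)))
          = (case y of (M, \<phi>, \<mu>, \<mu>0) \<Rightarrow> diffusion_quotient \<alpha> \<beta> M \<phi> \<mu> \<xi> \<epsilon>)"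
        unfolding y prod.case mode_mass_def diffusion_quotient_def x_def[symmetric] divide_divide_eq_right
        by (simp only: divide_divide_eq_left)
    qed
  qed
  moreover have "(case y of (M, \<phi>, \<mu>, \<mu>0) \<Rightarrow> of_real \<mu>0) / of_real (limit_mass \<alpha> \<beta> y)
      = (case y of (M, \<phi>, \<mu>, \<mu>0) \<Rightarrow> complex_of_real (kappa \<alpha> \<beta> M \<mu>0))" if "y \<in> ?X" for y
  proof -
    obtain M \<phi> \<mu> \<mu>0 where y: "y = (M, \<phi>, \<mu>, \<mu>0)" by (cases y)
    have M: "equilibrium C \<alpha> \<beta> M" using that unfolding y admissible_def by blast
    have "\<bar>M v\<bar> = M v" for v using equilibrium_nonneg[OF M \<alpha>(2), of v] by simp
    then show ?thesis unfolding y limit_mass_def kappa_def by simp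
  qed
  ultimately show ?thesis by (simp only: uniform_limit_cong)
qed

text \<open>The rate and its range are quantified before the data, so they can depend only on the
  exponents, the constants \<open>C\<close>, \<open>lam\<close> and \<open>\<xi>\<close>. This is
  why the limit is first established uniformly over the admissible data: the rate is read off from
  that uniform limit, and the pointwise limit is its value at one datum.\<close>

theorem lemma1p3:
  fixes \<alpha> :: ereal and \<beta> lam :: real and C :: "'n::finite hyp_consts" and \<xi> :: "real ^ 'n"
  assumes "\<alpha> + ereal \<beta> > 0" and "\<alpha> \<ge> 0" and "lam > 0" and "\<xi> \<noteq> 0"
  shows "\<exists>\<omega> \<epsilon>0. (\<omega> \<longlongrightarrow> (0::real)) (at_right 0) \<and> \<epsilon>0 > 0 \<and>
    (\<forall>M L DL Dt chi \<phi> \<mu> \<mu>0 \<Phi> \<Omega>.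
       equilibrium C \<alpha> \<beta> M \<longrightarrow>
       weighted_coercivity \<beta> lam M L DL Dt \<longrightarrow>
       large_velocity C \<alpha> \<beta> M L DL chi \<longrightarrow>
       fluid_mode C \<alpha> \<beta> lam M L Dt \<phi> \<mu> \<mu>0 \<longrightarrow>
       mode_scaling C \<alpha> \<beta> M \<phi> \<mu> \<Phi> \<Omega> \<longrightarrow>
         ((\<lambda>\<epsilon>. diffusion_quotient \<alpha> \<beta> M \<phi> \<mu> \<xi> \<epsilon>)
            \<longlongrightarrow> complex_of_real (kappa \<alpha> \<beta> M \<mu>0)) (at_right 0) \<and>
         (\<forall>\<epsilon>\<in>{0<..<\<epsilon>0}.
            cmod (diffusion_quotient \<alpha> \<beta> M \<phi> \<mu> \<xi> \<epsilon> - of_real (kappa \<alpha> \<beta> M \<mu>0)) \<le> \<omega> \<epsilon>))"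
proof -
  note ul = diffusion_quotient_limit[OF assms(1,2,4), of C lam]
  from uniform_limit_rate[OF ul] obtain \<omega> \<epsilon>0 where \<omega>: "(\<omega> \<longlongrightarrow> 0) (at_right 0)" "\<epsilon>0 > 0"
    and le: "\<And>\<epsilon> y. \<epsilon> \<in> {0<..<\<epsilon>0} \<Longrightarrow> y \<in> admissible C \<alpha> \<beta> lam \<Longrightarrow>
      dist (case y of (M, \<phi>, \<mu>, \<mu>0) \<Rightarrow> diffusion_quotient \<alpha> \<beta> M \<phi> \<mu> \<xi> \<epsilon>)
        (case y of (M, \<phi>, \<mu>, \<mu>0) \<Rightarrow> of_real (kappa \<alpha> \<beta> M \<mu>0)) \<le> \<omega> \<epsilon>"
    by blast
  show ?thesis
  proof (rule exI[of _ \<omega>], rule exI[of _ \<epsilon>0], intro conjI allI impI ballI \<omega>)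
    fix M L DL Dt chi \<phi> \<mu> \<mu>0 \<Phi> \<Omega>
    assume "equilibrium C \<alpha> \<beta> M" "fluid_mode C \<alpha> \<beta> lam M L Dt \<phi> \<mu> \<mu>0" "mode_scaling C \<alpha> \<beta> M \<phi> \<mu> \<Phi> \<Omega>"
    then have y: "(M, \<phi>, \<mu>, \<mu>0) \<in> admissible C \<alpha> \<beta> lam" unfolding admissible_def by blast
    show "((\<lambda>\<epsilon>. diffusion_quotient \<alpha> \<beta> M \<phi> \<mu> \<xi> \<epsilon>) \<longlongrightarrow> complex_of_real (kappa \<alpha> \<beta> M \<mu>0)) (at_right 0)"
      using tendsto_uniform_limitI[OF ul y] by simp
    show "cmod (diffusion_quotient \<alpha> \<beta> M \<phi> \<mu> \<xi> \<epsilon> - of_real (kappa \<alpha> \<beta> M \<mu>0)) \<le> \<omega> \<epsilon>"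
      if "\<epsilon> \<in> {0<..<\<epsilon>0}" for \<epsilon>
      using le[OF that y] by (simp add: dist_norm)
  qed
qed

end
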